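(* Every face of a Bruhat interval polytope is itself a Bruhat interval polytope. That is, if $u\leq v$ in $S_n$ and $F$ is a (nonempty) face of $\mathsf{Q}_{u,v}$, then there exist $x\leq y$ in $S_n$ such that $F=\mathsf{Q}_{x,y}$.
   Context: $S_n$ carries the (strong) Bruhat order $\leq$. Each $z\in S_n$ is identified with the vector $(z(1),\dots,z(n))\in\mathbb{R}^n$. For $u\leq v$ in $S_n$, the Bruhat interval polytope $\mathsf{Q}_{u,v}\subset\mathbb{R}^n$ is the convex hull of all vectors $(z(1),\dots,z(n))$ with $z\in S_n$, $u\leq z\leq v$. *)

theory Defs
  imports "HOL-Analysis.Analysis" "HOL-Combinatorics.Permutations"
begin

definition inversions :: "nat \<Rightarrow> (nat \<Rightarrow> nat) \<Rightarrow> (nat \<times> nat) set" where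
  "inversions n w = {(i, j). 1 \<le> i \<and> i < j \<and> j \<le> n \<and> w j < w i}"

definition perm_length :: "nat \<Rightarrow> (nat \<Rightarrow> nat) \<Rightarrow> nat" where
  "perm_length n w = card (inversions n w)"

(* An arrow u -> u t of the Bruhat graph of S_n, with t a transposition
   (not necessarily adjacent) that increases the length. *)
definition bruhat_step :: "nat \<Rightarrow> (nat \<Rightarrow> nat) \<Rightarrow> (nat \<Rightarrow> nat) \<Rightarrow> bool" where
  "bruhat_step n u v \<longleftrightarrow>
     (\<exists>i\<in>{1..n}. \<exists>j\<in>{1..n}. i \<noteq> j \<and> v = u \<circ> Transposition.transpose i j
        \<and> perm_length n u < perm_length n v)"

definition bruhat_le :: "nat \<Rightarrow> (nat \<Rightarrow> nat) \<Rightarrow> (nat \<Rightarrow> nat) \<Rightarrow> bool" where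
  "bruhat_le n u v \<longleftrightarrow>
     u permutes {1..n} \<and> v permutes {1..n} \<and> (bruhat_step n)\<^sup>*\<^sup>* u v"

(* The point (z(1), ..., z(n)) of R^n.  The map e numbers the coordinates of
   the type real ^ 'n; it is meant to be a bijection from 'n onto {1..n}. *)
definition perm_vector :: "('n::finite \<Rightarrow> nat) \<Rightarrow> (nat \<Rightarrow> nat) \<Rightarrow> real ^ 'n" where
  "perm_vector e z = (\<chi> i. real (z (e i)))"

definition bruhat_interval_polytope ::
  "nat \<Rightarrow> ('n::finite \<Rightarrow> nat) \<Rightarrow> (nat \<Rightarrow> nat) \<Rightarrow> (nat \<Rightarrow> nat) \<Rightarrow> (real ^ 'n) set" where
  "bruhat_interval_polytope n e u v =
     convex hull (perm_vector e ` {z. z permutes {1..n} \<and> bruhat_le n u z \<and> bruhat_le n z v})"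

end

theory Submission imports Defs
begin

text \<open>
  A face of \<open>Q\<^sub>u\<^sub>v\<close> is the convex hull of those points of the Bruhat interval \<open>[u, v]\<close> at which some linear
  functional, with coefficients \<open>w\<close>, is maximal. What has to be shown is that the maximizers
  form a Bruhat interval.

  A step of the Bruhat graph that exchanges the positions \<open>p < q\<close> upwards changes the functional by a positive
  multiple of \<open>w p - w q\<close>, so whether it improves the functional depends on its label \<open>(p, q)\<close>
  only. Arrange all labels in a list \<open>A @ B\<close>, with the improving labels in \<open>A\<close>
  and the others in \<open>B\<close>, that is a reflection order. For a reflection order, every interval has
  exactly one saturated chain whose labels increase (\<open>chains_reflection_order\<close>). For the lexicographic order
  this is a direct greedy argument (\<open>lex_chains_unique\<close>); it extends to other orders because
  the number of increasing chains is invariant under commutations and Yang-Baxter moves (\<open>braid_chains\<close>), and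
  because these moves bring every set \<open>A\<close> of inversions of a linear order to the front
  (\<open>lex_refls_braid_section\<close>).

  Now let \<open>z\<close> be an element of \<open>[u, v]\<close> that no step inside the interval improves. The increasing chain from
  \<open>u\<close> to \<open>z\<close> cannot end with a label in \<open>B\<close>, and the one from \<open>z\<close> to \<open>v\<close> cannot start with a label in
  \<open>A\<close>. Hence they join to the increasing chain from \<open>u\<close> to \<open>v\<close>, and \<open>z\<close> is the element
  where this chain passes from \<open>A\<close> to \<open>B\<close>
  (\<open>local_maximum_is_turning_point\<close>, \<open>turning_point_unique\<close>). So local maxima are unique. Breaking ties
  among the neutral labels upwards or downwards, one concludes that there is only one Bruhat-maximal
  maximizer \<open>y\<close> and only one Bruhat-minimal maximizer \<open>x\<close>.

  It remains to see that the functional is constant on \<open>[x, y]\<close> (\<open>weight_constant\<close>). The ends \<open>x\<close> and \<open>y\<close> are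
  joined by an increasing chain with neutral labels. Restricting to neutral labels respects
  braid moves, so such a chain also exists for a reflection order adapted to \<open>- w\<close>, and it
  shows that \<open>x\<close> is the turning point for \<open>- w\<close>, that is, a minimizer of \<open>w\<close> on \<open>[x, y]\<close>.
\<close>

section \<open>Transpositions, inversions and covers\<close>

(* keeps the position set in the form {1..n}, which the rules below are stated for *)
declare One_nat_def [simp del]

text \<open>
  The pair \<open>(i, j)\<close> stands for the transposition of the positions \<open>i\<close> and \<open>j\<close>, that
  is, for a label of the Bruhat graph.
\<close>

definition act :: "(nat \<Rightarrow> nat) \<Rightarrow> nat \<times> nat \<Rightarrow> nat \<Rightarrow> nat" where
  "act u r = u \<circ> Transposition.transpose (fst r) (snd r)"

definition refls :: "nat \<Rightarrow> (nat \<times> nat) set" where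
  "refls n = {(i, j). 1 \<le> i \<and> i < j \<and> j \<le> n}"

definition covers :: "nat \<Rightarrow> (nat \<Rightarrow> nat) \<Rightarrow> nat \<times> nat \<Rightarrow> bool" where
  "covers n u r \<longleftrightarrow> perm_length n (act u r) = Suc (perm_length n u)"

lemma act_apply [simp]:
  "act u (i, j) k = (if k = i then u j else if k = j then u i else u k)"
  by (simp add: act_def transpose_def)

lemma act_act [simp]: "act (act u r) r = u"
  by (simp add: act_def comp_assoc)

lemma act_permutes:
  assumes "u permutes {1..n}" "r \<in> refls n"
  shows "act u r permutes {1..n}"
  using assms unfolding act_def refls_def
  by (auto intro!: permutes_compose permutes_swap_id)

lemma finite_inversions [simp]: "finite (inversions n w)"
  by (rule finite_subset[of _ "{1..n} \<times> {1..n}"]) (auto simp: inversions_def)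

text \<open>
  This correspondence compares the inversions of \<open>u\<close> with those of \<open>act u (i, j)\<close>: move both
  positions of a pair by the transposition, unless this reverses their order. Away from \<open>(i, j)\<close>
  it is an involution, and when \<open>u i < u j\<close> it turns inversions into inversions other than
  \<open>(i, j)\<close>. Hence going up adds at least one to the length, and exactly one if no value between \<open>u i\<close>
  and \<open>u j\<close> sits between the two positions.
\<close>

definition reflect_pair :: "nat \<times> nat \<Rightarrow> nat \<times> nat \<Rightarrow> nat \<times> nat" where
  "reflect_pair r = (\<lambda>(k, l). let t = Transposition.transpose (fst r) (snd r)
     in if t k < t l then (t k, t l) else (k, l))"

lemma reflect_pair_involution:
  "fst x < snd x \<Longrightarrow> reflect_pair r (reflect_pair r x) = x"
  by (auto simp: reflect_pair_def Let_def split: prod.splits if_splits)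

lemma reflect_pair_inj: "inj_on (reflect_pair r) (inversions n w)"
  by (rule inj_on_inverseI[of _ "reflect_pair r"])
     (auto intro!: reflect_pair_involution simp: inversions_def)

lemma reflect_inversions_up:
  assumes "(i, j) \<in> refls n" "u i < u j"
  shows "reflect_pair (i, j) ` inversions n u \<subseteq> inversions n (act u (i, j)) - {(i, j)}"
proof (rule image_subsetI, unfold split_paired_all)
  fix k l assume kl: "(k, l) \<in> inversions n u"
  have "1 \<le> i" "i < j" "j \<le> n" using assms by (auto simp: refls_def)
  moreover have "1 \<le> k" "k < l" "l \<le> n" "u l < u k" using kl by (auto simp: inversions_def)
  ultimately show "reflect_pair (i, j) (k, l) \<in> inversions n (act u (i, j)) - {(i, j)}"
    using assms(2)
    by (cases "k = i"; cases "k = j"; cases "l = i"; cases "l = j")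
       (simp_all add: inversions_def reflect_pair_def Let_def)
qed

lemma reflect_inversions_down:
  assumes "(i, j) \<in> refls n" "u i < u j" "\<And>k. i < k \<Longrightarrow> k < j \<Longrightarrow> u k < u i \<or> u j < u k"
  shows "reflect_pair (i, j) ` (inversions n (act u (i, j)) - {(i, j)}) \<subseteq> inversions n u"
proof (rule image_subsetI, unfold split_paired_all)
  fix k l assume "(k, l) \<in> inversions n (act u (i, j)) - {(i, j)}"
  then have kl: "(k, l) \<in> inversions n (act u (i, j))" "(k, l) \<noteq> (i, j)" by auto
  have "1 \<le> i" "i < j" "j \<le> n" using assms by (auto simp: refls_def)
  moreover have "1 \<le> k" "k < l" "l \<le> n" "act u (i, j) l < act u (i, j) k"
    using kl by (auto simp: inversions_def)
  ultimately show "reflect_pair (i, j) (k, l) \<in> inversions n u"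
    using assms(2) assms(3)[of k] assms(3)[of l] kl(2)
    by (cases "k = i"; cases "k = j"; cases "l = i"; cases "l = j")
       (auto simp add: inversions_def reflect_pair_def Let_def)
qed

lemma length_act_less:
  assumes "(i, j) \<in> refls n" "u i < u j"
  shows "perm_length n u < perm_length n (act u (i, j))"
proof -
  have m: "(i, j) \<in> inversions n (act u (i, j))"
    using assms by (auto simp: inversions_def refls_def)
  have "card (inversions n u) = card (reflect_pair (i, j) ` inversions n u)"
    by (simp add: card_image reflect_pair_inj)
  also have "\<dots> \<le> card (inversions n (act u (i, j)) - {(i, j)})"
    by (intro card_mono reflect_inversions_up assms) auto
  also have "\<dots> < card (inversions n (act u (i, j)))"
    using m by (intro card_Diff1_less) auto
  finally show ?thesis by (simp add: perm_length_def)
qed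

lemma length_act_less_iff:
  assumes "u permutes {1..n}" "(i, j) \<in> refls n"
  shows "perm_length n u < perm_length n (act u (i, j)) \<longleftrightarrow> u i < u j"
proof
  assume a: "perm_length n u < perm_length n (act u (i, j))"
  have "u i \<noteq> u j"
    using assms permutes_inj[OF assms(1)] by (auto simp: refls_def inj_def)
  moreover have "\<not> u j < u i"
    using length_act_less[of i j n "act u (i, j)"] assms(2) a by (auto simp: refls_def)
  ultimately show "u i < u j" by simp
qed (use length_act_less assms in blast)

lemma covers_imp_less:
  assumes "u permutes {1..n}" "(i, j) \<in> refls n" "covers n u (i, j)"
  shows "u i < u j"
  using assms length_act_less_iff[of u n i j] by (simp add: covers_def)

lemma coversI:
  assumes "(i, j) \<in> refls n" "u i < u j" "\<And>k. i < k \<Longrightarrow> k < j \<Longrightarrow> u k < u i \<or> u j < u k"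
  shows "covers n u (i, j)"
proof -
  have m: "(i, j) \<in> inversions n (act u (i, j))"
    using assms by (auto simp: inversions_def refls_def)
  have "reflect_pair (i, j) ` inversions n u \<subseteq> inversions n (act u (i, j)) - {(i, j)}"
    by (intro reflect_inversions_up assms)
  moreover have "inversions n (act u (i, j)) - {(i, j)} \<subseteq> reflect_pair (i, j) ` inversions n u"
  proof
    fix x assume x: "x \<in> inversions n (act u (i, j)) - {(i, j)}"
    then have "reflect_pair (i, j) x \<in> inversions n u"
      using reflect_inversions_down[of i j n u] assms by blast
    moreover have "x = reflect_pair (i, j) (reflect_pair (i, j) x)"
      using x by (intro reflect_pair_involution[symmetric]) (auto simp: inversions_def)
    ultimately show "x \<in> reflect_pair (i, j) ` inversions n u" by blast
  qed
  ultimately have "Suc (card (inversions n u)) = Suc (card (inversions n (act u (i, j)) - {(i, j)}))"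
    using card_image[OF reflect_pair_inj, of "(i, j)" n u] by simp
  also have "\<dots> = card (inversions n (act u (i, j)))"
    using m by (intro card_Suc_Diff1) auto
  finally show ?thesis by (simp add: covers_def perm_length_def)
qed

text \<open>
  A value in between allows one to reach \<open>act u (i, j)\<close> in three upward steps
  \<open>123, 213, 231, 321\<close>, so that the length grows by at least three.
\<close>

lemma covers_no_between:
  assumes u: "u permutes {1..n}" and ij: "(i, j) \<in> refls n" and c: "covers n u (i, j)"
    and k: "i < k" "k < j"
  shows "\<not> (u i < u k \<and> u k < u j)"
proof
  assume b: "u i < u k \<and> u k < u j"
  have r: "(i, k) \<in> refls n" "(k, j) \<in> refls n"
    using ij k by (auto simp: refls_def)
  let ?v = "act u (i, k)" and ?w = "act (act u (i, k)) (k, j)"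
  have "perm_length n u < perm_length n ?v"
    using r b by (intro length_act_less) auto
  moreover have "perm_length n ?v < perm_length n ?w"
    using r b k by (intro length_act_less) auto
  moreover have "perm_length n ?w < perm_length n (act ?w (i, k))"
    using r b k by (intro length_act_less) auto
  moreover have "act ?w (i, k) = act u (i, j)"
    using k by (auto simp: fun_eq_iff)
  ultimately show False using c by (simp add: covers_def)
qed

text \<open>
  Each label of the list is either skipped or used once, so this counts the saturated chains from \<open>u\<close> to
  \<open>v\<close> whose labels increase in the order given by the list \<open>R\<close>. In operator form this is the matrix entry of
  \<open>\<Prod>\<^sub>r (1 + C\<^sub>r)\<close>, where \<open>C\<^sub>r\<close> moves a permutation along the cover with label \<open>r\<close> if there is one and
  kills it otherwise; concatenation of lists is the product of matrices.
\<close>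

fun chain_count :: "nat \<Rightarrow> (nat \<times> nat) list \<Rightarrow> (nat \<Rightarrow> nat) \<Rightarrow> (nat \<Rightarrow> nat) \<Rightarrow> nat" where
  "chain_count n [] u v = (if u = v then 1 else 0)"
| "chain_count n (r # R) u v =
     chain_count n R u v + (if covers n u r then chain_count n R (act u r) v else 0)"

lemma chains_append:
  assumes "u permutes {1..n}" "set A \<subseteq> refls n"
  shows "chain_count n (A @ B) u v = (\<Sum>z | z permutes {1..n}. chain_count n A u z * chain_count n B z v)"
  using assms
proof (induction A arbitrary: u)
  case Nil
  have fin: "finite {z. z permutes {1..n}}" by (rule finite_permutations) simp
  have "(\<Sum>z | z permutes {1..n}. chain_count n [] u z * chain_count n B z v)
     = (\<Sum>z | z permutes {1..n}. if u = z then chain_count n B z v else 0)"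
    by (intro sum.cong) auto
  then show ?case using Nil fin by (simp add: sum.delta')
next
  case (Cons r A)
  then show ?case
    by (auto simp: act_permutes sum.distrib distrib_right)
qed

lemma chains_cong_prefix:
  assumes "\<And>u. u permutes {1..n} \<Longrightarrow> chain_count n R u v = chain_count n S u v"
    and "u permutes {1..n}" "set P \<subseteq> refls n"
  shows "chain_count n (P @ R) u v = chain_count n (P @ S) u v"
  using assms(2,3) by (induction P arbitrary: u) (auto simp: assms(1) act_permutes)

text \<open>
  Every upward step adds at least one to the length, so if two of them add exactly two, both are
  covers. This trades conditions on the intermediate permutation for comparisons of values and a
  condition on the end point.
\<close>

lemma covers_covers:
  assumes "u permutes {1..n}" "(i, j) \<in> refls n" "(k, l) \<in> refls n"
  shows "covers n u (i, j) \<and> covers n (act u (i, j)) (k, l) \<longleftrightarrow>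
    u i < u j \<and> act u (i, j) k < act u (i, j) l \<and>
    perm_length n (act (act u (i, j)) (k, l)) = perm_length n u + 2"
proof -
  have "perm_length n u < perm_length n (act u (i, j)) \<longleftrightarrow> u i < u j"
    using assms by (intro length_act_less_iff)
  moreover have "perm_length n (act u (i, j)) < perm_length n (act (act u (i, j)) (k, l))
     \<longleftrightarrow> act u (i, j) k < act u (i, j) l"
    using assms by (intro length_act_less_iff act_permutes)
  ultimately show ?thesis unfolding covers_def by linarith
qed

definition apart :: "nat \<times> nat \<Rightarrow> nat \<times> nat \<Rightarrow> bool" where
  "apart r s \<longleftrightarrow> {fst r, snd r} \<inter> {fst s, snd s} = {}"

lemma chains_commute:
  assumes u: "u permutes {1..n}" and r: "r \<in> refls n" "s \<in> refls n" and "apart r s"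
  shows "chain_count n (r # s # R) u v = chain_count n (s # r # R) u v"
proof -
  obtain i j k l where eq: "r = (i, j)" "s = (k, l)" by (cases r, cases s)
  have d: "i \<noteq> k" "i \<noteq> l" "j \<noteq> k" "j \<noteq> l"
    using assms(4) by (auto simp: eq apart_def)
  have com: "act (act u r) s = act (act u s) r"
    using d by (auto simp: eq fun_eq_iff)
  have "covers n u r \<and> covers n (act u r) s \<longleftrightarrow> covers n u s \<and> covers n (act u s) r"
    using covers_covers[OF u, of i j k l] covers_covers[OF u, of k l i j] r d com
    by (auto simp: eq)
  then show ?thesis by (auto simp: com)
qed

text \<open>
  The operators \<open>C\<^sub>r\<close> satisfy the relations of the Fomin-Kirillov quadratic algebra, which imply
  the Yang-Baxter equation for \<open>1 + C\<^sub>r\<close>. Expanding both sides, the terms with a given end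
  point agree: the two 3-cycles \<open>?p\<close> and \<open>?q\<close> are reached by paths whose upward
  conditions depend on the relative order of three values only.
\<close>

lemma chains_yang_baxter:
  assumes u: "u permutes {1..n}" and abc: "1 \<le> a" "a < b" "b < c" "c \<le> n"
  shows "chain_count n ((a,b) # (a,c) # (b,c) # R) u v = chain_count n ((b,c) # (a,c) # (a,b) # R) u v"
proof -
  have r: "(a,b) \<in> refls n" "(a,c) \<in> refls n" "(b,c) \<in> refls n"
    using abc by (auto simp: refls_def)
  have ne: "u a \<noteq> u b" "u a \<noteq> u c" "u b \<noteq> u c"
    using abc by (simp_all add: inj_eq[OF permutes_inj[OF u]])
  let ?p = "act (act u (a,b)) (a,c)" and ?q = "act (act u (a,b)) (b,c)"
  let ?f = "\<lambda>w. chain_count n R w v"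
  have p: "act (act u (b,c)) (a,b) = ?p" "act (act u (a,c)) (b,c) = ?p"
    using abc by (auto simp: fun_eq_iff)
  have q: "act (act u (b,c)) (a,c) = ?q" "act (act u (a,c)) (a,b) = ?q"
    using abc by (auto simp: fun_eq_iff)
  have w: "act ?p (b,c) = act u (a,c)" "act ?q (a,b) = act u (a,c)"
    using abc by (auto simp: fun_eq_iff)
  define P where "P \<longleftrightarrow> perm_length n ?p = perm_length n u + 2"
  define Q where "Q \<longleftrightarrow> perm_length n ?q = perm_length n u + 2"
  note cc = covers_covers[OF u]
  have 1: "covers n u (a,b) \<and> covers n (act u (a,b)) (a,c) \<longleftrightarrow> u a < u b \<and> u b < u c \<and> P"
    using cc[OF r(1) r(2)] abc by (auto simp: P_def)
  have 2: "covers n u (a,b) \<and> covers n (act u (a,b)) (b,c) \<longleftrightarrow> u a < u b \<and> u a < u c \<and> Q"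
    using cc[OF r(1) r(3)] abc by (auto simp: Q_def)
  have 3: "covers n u (a,c) \<and> covers n (act u (a,c)) (b,c) \<longleftrightarrow> u a < u c \<and> u b < u a \<and> P"
    using cc[OF r(2) r(3)] abc by (auto simp: P_def p)
  have 4: "covers n u (b,c) \<and> covers n (act u (b,c)) (a,b) \<longleftrightarrow> u b < u c \<and> u a < u c \<and> P"
    using cc[OF r(3) r(1)] abc by (auto simp: P_def p)
  have 5: "covers n u (b,c) \<and> covers n (act u (b,c)) (a,c) \<longleftrightarrow> u b < u c \<and> u a < u b \<and> Q"
    using cc[OF r(3) r(2)] abc by (auto simp: Q_def q)
  have 6: "covers n u (a,c) \<and> covers n (act u (a,c)) (a,b) \<longleftrightarrow> u a < u c \<and> u c < u b \<and> Q"
    using cc[OF r(2) r(1)] abc by (auto simp: Q_def q)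
  have pp: "?p permutes {1..n}" "?q permutes {1..n}"
    using u r by (auto intro!: act_permutes)
  have 7: "covers n ?p (b,c) \<longleftrightarrow> perm_length n (act u (a,c)) = Suc (perm_length n ?p)"
    "covers n ?q (a,b) \<longleftrightarrow> perm_length n (act u (a,c)) = Suc (perm_length n ?q)"
    by (simp_all only: covers_def w)
  have up: "perm_length n ?p < perm_length n (act u (a,c)) \<longleftrightarrow> u a < u b"
    "perm_length n ?q < perm_length n (act u (a,c)) \<longleftrightarrow> u b < u c"
    using length_act_less_iff[OF pp(1) r(3)] length_act_less_iff[OF pp(2) r(1)] abc 
    unfolding w by simp_all
  have e1: "chain_count n ((a,b) # (a,c) # (b,c) # R) u v =
     ?f u + (if covers n u (a,b) then ?f (act u (a,b)) else 0)
      + (if covers n u (a,c) then ?f (act u (a,c)) else 0)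
      + (if covers n u (b,c) then ?f (act u (b,c)) else 0)
      + (if covers n u (a,b) \<and> covers n (act u (a,b)) (a,c) then ?f ?p else 0)
      + (if covers n u (a,b) \<and> covers n (act u (a,b)) (b,c) then ?f ?q else 0)
      + (if covers n u (a,c) \<and> covers n (act u (a,c)) (b,c) then ?f ?p else 0)
      + (if (covers n u (a,b) \<and> covers n (act u (a,b)) (a,c)) \<and> covers n ?p (b,c)
         then ?f (act u (a,c)) else 0)"
    by (simp only: chain_count.simps p q w) auto
  have e2: "chain_count n ((b,c) # (a,c) # (a,b) # R) u v =
     ?f u + (if covers n u (a,b) then ?f (act u (a,b)) else 0)
      + (if covers n u (a,c) then ?f (act u (a,c)) else 0)
      + (if covers n u (b,c) then ?f (act u (b,c)) else 0)
      + (if covers n u (b,c) \<and> covers n (act u (b,c)) (a,c) then ?f ?q else 0)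
      + (if covers n u (b,c) \<and> covers n (act u (b,c)) (a,b) then ?f ?p else 0)
      + (if covers n u (a,c) \<and> covers n (act u (a,c)) (a,b) then ?f ?q else 0)
      + (if (covers n u (b,c) \<and> covers n (act u (b,c)) (a,c)) \<and> covers n ?q (a,b)
         then ?f (act u (a,c)) else 0)"
    by (simp only: chain_count.simps p q w) auto
  have 8: "u a < u b \<Longrightarrow> u b < u c \<Longrightarrow> 
     (P \<and> covers n ?p (b,c) \<longleftrightarrow> Q \<and> covers n ?q (a,b))"
  proof -
    assume l: "u a < u b" "u b < u c"
    have "perm_length n u < perm_length n (act u (a,b))"
      "perm_length n (act u (a,b)) < perm_length n ?p"
      "perm_length n (act u (a,b)) < perm_length n ?q"
      using abc r l by (auto intro!: length_act_less)
    with up l show ?thesis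
      unfolding 7 P_def Q_def by linarith
  qed
  show ?thesis
    unfolding e1 e2 1 2 3 4 5 6 using ne 8 by auto
qed

section \<open>Reflection orders and braid moves\<close>

text \<open>
  Lists of transpositions up to exchanging disjoint neighbours and reversing blocks
  \<open>(a,b), (a,c), (b,c)\<close>. A reflection order is a list equivalent to the
  lexicographic list of all transpositions. Keeping this relation syntactic, instead of comparing
  chain counts, makes it possible to restrict equivalent lists to a sublist of labels.
\<close>

inductive braid :: "(nat \<times> nat) list \<Rightarrow> (nat \<times> nat) list \<Rightarrow> bool" (infix "\<asymp>" 50) where
  refl [simp]: "R \<asymp> R"
| sym: "R \<asymp> S \<Longrightarrow> S \<asymp> R"
| trans [trans]: "R \<asymp> S \<Longrightarrow> S \<asymp> T \<Longrightarrow> R \<asymp> T"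
| commute: "apart r s \<Longrightarrow> P @ r # s # Q \<asymp> P @ s # r # Q"
| yang_baxter: "a < b \<Longrightarrow> b < c \<Longrightarrow>
    P @ (a,b) # (a,c) # (b,c) # Q \<asymp> P @ (b,c) # (a,c) # (a,b) # Q"

lemma braid_context: "R \<asymp> S \<Longrightarrow> P @ R @ Q \<asymp> P @ S @ Q"
proof (induction rule: braid.induct)
  case (commute r s P' Q')
  then show ?case using braid.commute[of r s "P @ P'" "Q' @ Q"] by simp
next
  case (yang_baxter a b c P' Q')
  then show ?case using braid.yang_baxter[of a b c "P @ P'" "Q' @ Q"] by simp
qed (auto intro: braid.intros)

lemma braid_append: "R \<asymp> R' \<Longrightarrow> S \<asymp> S' \<Longrightarrow> R @ S \<asymp> R' @ S'"
  using braid_context[of R R' "[]" S] braid_context[of S S' R' "[]"] braid.trans by simp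

lemma braid_set: "R \<asymp> S \<Longrightarrow> set R = set S"
  by (induction rule: braid.induct) auto

lemma braid_chains:
  assumes "R \<asymp> S" "set R \<subseteq> refls n" "u permutes {1..n}"
  shows "chain_count n R u v = chain_count n S u v"
  using assms
proof (induction arbitrary: u rule: braid.induct)
  case (commute r s P Q)
  then show ?case
    by (intro chains_cong_prefix chains_commute) auto
next
  case (yang_baxter a b c P Q)
  then show ?case
    by (intro chains_cong_prefix chains_yang_baxter) (auto simp: refls_def)
qed (auto simp: braid_set)

text \<open>
  The labels inside the level sets of \<open>w\<close> belong to a reflection subgroup: of the three pairs in a
  block \<open>(a,b), (a,c), (b,c)\<close>, either all, exactly one, or none survive, so each move
  restricts to a move or to an equality.
\<close>

lemma braid_filter_level:
  assumes "R \<asymp> S"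
  shows "filter (\<lambda>(p, q). w p = w q) R \<asymp> filter (\<lambda>(p, q). w p = w q) S"
  using assms
proof (induction rule: braid.induct)
  case (commute r s P Q)
  then show ?case by (auto intro: braid.intros)
next
  case (yang_baxter a b c P Q)
  then show ?case
    by (cases "w a = w b"; cases "w b = w c"; cases "w a = w c")
      (auto intro: braid.intros)
qed (auto intro: braid.intros)

lemma braid_move_right: "\<forall>s\<in>set S. apart r s \<Longrightarrow> r # S \<asymp> S @ [r]"
proof (induction S)
  case (Cons s S)
  have "r # s # S \<asymp> s # r # S"
    using Cons.prems braid.commute[of r s "[]" S] by simp
  also have "s # r # S \<asymp> s # S @ [r]"
    using Cons braid_context[of "r # S" "S @ [r]" "[s]" "[]"] by simp
  finally show ?case by simp
qed simp

lemma braid_swap_blocks: "\<forall>r\<in>set R. \<forall>s\<in>set S. apart r s \<Longrightarrow> R @ S \<asymp> S @ R"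
proof (induction R)
  case (Cons r R)
  have "(r # R) @ S \<asymp> r # S @ R"
    using Cons braid_context[of "R @ S" "S @ R" "[r]" "[]"] by simp
  also have "r # S @ R \<asymp> S @ r # R"
    using Cons.prems braid_append[OF braid_move_right[of S r] braid.refl[of R]] by simp
  finally show ?case .
qed simp

text \<open>
  One may picture a reflection order as a wiring diagram in which any two of \<open>n\<close> wires cross once;
  here wire \<open>m\<close> crosses the wires \<open>xs\<close> one after the other.
\<close>

definition sweep :: "nat \<Rightarrow> nat list \<Rightarrow> (nat \<times> nat) list" where
  "sweep m xs = map (Pair m) xs"

lemma sweep_simps [simp]:
  "sweep m [] = []" "sweep m (x # xs) = (m, x) # sweep m xs"
  "sweep m (xs @ ys) = sweep m xs @ sweep m ys"
  "set (sweep m xs) = Pair m ` set xs"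
  by (auto simp: sweep_def)

text \<open>
  A crossing of two wires can be pushed past all the wires that both of them cross.
\<close>

lemma braid_two_sweeps:
  assumes "l < m" "distinct xs" "\<forall>x\<in>set xs. m < x"
  shows "(l, m) # sweep l xs @ sweep m xs \<asymp> sweep m xs @ sweep l xs @ [(l, m)]"
  using assms
proof (induction xs)
  case (Cons x xs)
  have "(l, m) # sweep l (x # xs) @ sweep m (x # xs)
      = [(l, m), (l, x)] @ (sweep l xs @ [(m, x)]) @ sweep m xs" by simp
  also have "\<dots> \<asymp> [(l, m), (l, x)] @ ([(m, x)] @ sweep l xs) @ sweep m xs"
    using Cons.prems by (intro braid_context braid_swap_blocks) (auto simp: apart_def)
  also have "\<dots> = [] @ [(l, m), (l, x), (m, x)] @ sweep l xs @ sweep m xs" by simp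
  also have "\<dots> \<asymp> [] @ [(m, x), (l, x), (l, m)] @ sweep l xs @ sweep m xs"
    using Cons.prems braid.yang_baxter[of l m x "[]" "[]"] by (intro braid_context) auto
  also have "\<dots> = [(m, x), (l, x)] @ ((l, m) # sweep l xs @ sweep m xs) @ []" by simp
  also have "\<dots> \<asymp> [(m, x), (l, x)] @ (sweep m xs @ sweep l xs @ [(l, m)]) @ []"
    using Cons by (intro braid_context) auto
  also have "\<dots> = [(m, x)] @ ([(l, x)] @ sweep m xs) @ sweep l xs @ [(l, m)]" by simp
  also have "\<dots> \<asymp> [(m, x)] @ (sweep m xs @ [(l, x)]) @ sweep l xs @ [(l, m)]"
    using Cons.prems by (intro braid_context braid_swap_blocks) (auto simp: apart_def)
  finally show ?case by simp
qed simp

definition lex_refls :: "nat \<Rightarrow> nat \<Rightarrow> (nat \<times> nat) list" where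
  "lex_refls m n = concat (map (\<lambda>p. sweep p [Suc p..<n+1]) [m..<n+1])"

lemma lex_refls_empty: "n < m \<Longrightarrow> lex_refls m n = []"
  by (simp add: lex_refls_def)

lemma lex_refls_unfold: "m \<le> n \<Longrightarrow> lex_refls m n = sweep m [Suc m..<n+1] @ lex_refls (Suc m) n"
  by (simp add: lex_refls_def upt_conv_Cons)

lemma set_lex_refls: "set (lex_refls m n) = {(i, j). m \<le> i \<and> i < j \<and> j \<le> n}"
proof -
  have "set (lex_refls m n) = (\<Union>p\<in>{m..<n+1}. Pair p ` {Suc p..<n+1})"
    by (simp add: lex_refls_def)
  also have "\<dots> = {(i, j). m \<le> i \<and> i < j \<and> j \<le> n}"
    by (auto simp: image_iff)
  finally show ?thesis .
qed

lemma sorted_wrt_split: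
  assumes "sorted_wrt P xs" "transp P" "\<forall>x\<in>set xs. P x m \<or> P m x"
  shows "\<exists>ys zs. xs = ys @ zs \<and> (\<forall>y\<in>set ys. P y m) \<and> (\<forall>z\<in>set zs. P m z)"
  using assms(1,3)
proof (induction xs)
  case (Cons x xs)
  show ?case
  proof (cases "P m x")
    case True
    then have "\<forall>z\<in>set (x # xs). P m z"
      using Cons.prems transpD[OF assms(2)] by auto
    then show ?thesis by (intro exI[of _ "[]"] exI[of _ "x # xs"]) auto
  next
    case False
    obtain ys zs where "xs = ys @ zs" "\<forall>y\<in>set ys. P y m" "\<forall>z\<in>set zs. P m z"
      using Cons by auto
    with False Cons.prems show ?thesis
      by (intro exI[of _ "x # ys"] exI[of _ zs]) auto
  qed
qed simp

text \<open>
  Every linear order \<open>P\<close> of the positions gives a reflection order that begins with the pairs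
  \<open>p < q\<close> inverted by \<open>P\<close>. In the wiring picture, the wires stand in the order \<open>xs\<close> after
  the crossings in \<open>A\<close>. The induction adds a wire \<open>m\<close> smaller than all others: it first crosses
  all wires, its sweep is pushed behind \<open>A\<close>, where it meets the wires in the order \<open>xs\<close>, and it
  is cut where \<open>m\<close> belongs in this order; the first half is added to \<open>A\<close> and
  the rest to \<open>B\<close>. The last clause, which says that the sweep of a still smaller wire can be pushed behind
  \<open>A\<close>, is what this step consumes and must reproduce.
\<close>

lemma lex_refls_braid_section:
  assumes P: "transp P" "asymp P" "totalp P"
    and "m \<le> Suc n"
  shows "\<exists>xs A B. distinct xs \<and> set xs = {m..n} \<and> sorted_wrt P xs
     \<and> lex_refls m n \<asymp> A @ B
     \<and> set A = {(p, q). m \<le> p \<and> p < q \<and> q \<le> n \<and> P q p}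
     \<and> set B = {(p, q). m \<le> p \<and> p < q \<and> q \<le> n \<and> P p q}
     \<and> (\<forall>l<m. sweep l [m..<n+1] @ A \<asymp> A @ sweep l xs)"
  using assms(4)
proof (induction m rule: inc_induct)
  case base
  show ?case
    by (rule exI[of _ "[]"])+ (auto simp: lex_refls_empty)
next
  case (step m)
  have m: "m \<le> n" using step.hyps by simp
  obtain xs A B where xs: "distinct xs" "set xs = {Suc m..n}" "sorted_wrt P xs"
    and lex: "lex_refls (Suc m) n \<asymp> A @ B"
    and A: "set A = {(p, q). Suc m \<le> p \<and> p < q \<and> q \<le> n \<and> P q p}"
    and B: "set B = {(p, q). Suc m \<le> p \<and> p < q \<and> q \<le> n \<and> P p q}"
    and sweep: "\<And>l. l < Suc m \<Longrightarrow> sweep l [Suc m..<n+1] @ A \<asymp> A @ sweep l xs"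
    using step.IH by blast
  have "\<forall>x\<in>set xs. P x m \<or> P m x"
  proof
    fix x assume "x \<in> set xs"
    then have "x \<noteq> m" using xs(2) by auto
    then show "P x m \<or> P m x" using totalpD[OF P(3)] by blast
  qed
  then obtain ys zs where yz: "xs = ys @ zs" "\<forall>y\<in>set ys. P y m" "\<forall>z\<in>set zs. P m z"
    using sorted_wrt_split[OF xs(3) P(1)] by blast
  have asym: "P a b \<Longrightarrow> \<not> P b a" for a b using P(2) by (auto dest: asympD)
  have set_yz: "set ys = {q. m < q \<and> q \<le> n \<and> P q m}" "set zs = {q. m < q \<and> q \<le> n \<and> P m q}"
  proof -
    have *: "q \<in> set ys \<or> q \<in> set zs \<longleftrightarrow> m < q \<and> q \<le> n" for q
      using xs(2) yz(1) by (simp add: set_eq_iff Suc_le_eq)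
    show "set ys = {q. m < q \<and> q \<le> n \<and> P q m}" "set zs = {q. m < q \<and> q \<le> n \<and> P m q}"
      using * yz(2,3) asym by blast+
  qed
  have lexm: "lex_refls m n = sweep m [Suc m..<n+1] @ lex_refls (Suc m) n"
    by (rule lex_refls_unfold[OF m])
  show ?case
  proof (intro exI conjI allI impI)
    show "distinct (ys @ m # zs)"
      using xs(1) yz(1) set_yz by simp
    have "set (ys @ m # zs) = insert m (set xs)" by (simp add: yz(1))
    then show "set (ys @ m # zs) = {m..n}"
      using xs(2) atLeastAtMost_insertL[OF m] by simp
    show "sorted_wrt P (ys @ m # zs)"
      using xs(3) yz by (auto simp: sorted_wrt_append)
    have "lex_refls m n \<asymp> sweep m [Suc m..<n+1] @ A @ B"
      unfolding lexm using lex by (intro braid_append) auto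
    also have "\<dots> \<asymp> (A @ sweep m xs) @ B"
      using braid_append[OF sweep[of m] braid.refl[of B]] by simp
    finally show "lex_refls m n \<asymp> (A @ sweep m ys) @ (sweep m zs @ B)"
      by (simp add: yz(1))
    show "set (A @ sweep m ys) = {(p, q). m \<le> p \<and> p < q \<and> q \<le> n \<and> P q p}"
      using A set_yz by (auto simp: Suc_le_eq order_le_less)
    show "set (sweep m zs @ B) = {(p, q). m \<le> p \<and> p < q \<and> q \<le> n \<and> P p q}"
      using B set_yz by (auto simp: Suc_le_eq order_le_less)
    fix l assume l: "l < m"
    have "sweep l [m..<n+1] @ A @ sweep m ys
        = [(l, m)] @ (sweep l [Suc m..<n+1] @ A) @ sweep m ys"
      using m by (simp add: upt_conv_Cons)
    also have "\<dots> \<asymp> [(l, m)] @ (A @ sweep l xs) @ sweep m ys"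
      using l by (intro braid_context sweep) auto
    also have "\<dots> = [] @ ([(l, m)] @ A) @ sweep l ys @ sweep l zs @ sweep m ys"
      by (simp add: yz(1))
    also have "\<dots> \<asymp> [] @ (A @ [(l, m)]) @ sweep l ys @ sweep l zs @ sweep m ys"
      using l A by (intro braid_context braid_swap_blocks) (auto simp: apart_def)
    also have "\<dots> = (A @ [(l, m)] @ sweep l ys) @ (sweep l zs @ sweep m ys) @ []" by simp
    also have "\<dots> \<asymp> (A @ [(l, m)] @ sweep l ys) @ (sweep m ys @ sweep l zs) @ []"
    proof (intro braid_context braid_swap_blocks ballI)
      fix r s assume "r \<in> set (sweep l zs)" "s \<in> set (sweep m ys)"
      then obtain z y where "r = (l, z)" "s = (m, y)" "z \<in> set zs" "y \<in> set ys" by auto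
      moreover from this have "z \<noteq> y" using xs(1) yz(1) by auto
      ultimately show "apart r s" using l set_yz by (auto simp: apart_def)
    qed
    also have "\<dots> = A @ ((l, m) # sweep l ys @ sweep m ys) @ sweep l zs" by simp
    also have "\<dots> \<asymp> A @ (sweep m ys @ sweep l ys @ [(l, m)]) @ sweep l zs"
    proof (rule braid_context[OF braid_two_sweeps[OF l]])
      show "distinct ys" using xs(1) yz(1) by simp
      show "\<forall>y\<in>set ys. m < y" by (simp add: set_yz(1))
    qed
    finally show "sweep l [m..<n+1] @ A @ sweep m ys \<asymp> (A @ sweep m ys) @ sweep l (ys @ m # zs)"
      by simp
  qed
qed

section \<open>Bruhat order and increasing chains for the lexicographic order\<close>

text \<open>
  Rank matrices turn the Bruhat order into a condition on entries. An upward step only raises entries,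
  and their comparison with those of \<open>v\<close> is what tells whether a step from \<open>u\<close> stays below \<open>v\<close>
  in the construction of chains.
\<close>

definition rank_count :: "(nat \<Rightarrow> nat) \<Rightarrow> nat \<Rightarrow> nat \<Rightarrow> nat" where
  "rank_count w p q = card {k \<in> {1..p}. q \<le> w k}"

definition rank_le :: "(nat \<Rightarrow> nat) \<Rightarrow> (nat \<Rightarrow> nat) \<Rightarrow> bool" where
  "rank_le u v \<longleftrightarrow> (\<forall>p q. rank_count u p q \<le> rank_count v p q)"

lemma rank_count_Suc:
  "rank_count w (Suc p) q = rank_count w p q + (if q \<le> w (Suc p) then 1 else 0)"
proof -
  have "{k \<in> {1..Suc p}. q \<le> w k}
      = (if q \<le> w (Suc p) then insert (Suc p) {k \<in> {1..p}. q \<le> w k} else {k \<in> {1..p}. q \<le> w k})"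
    by (auto simp: le_Suc_eq)
  then show ?thesis by (simp add: rank_count_def)
qed

lemma rank_count_0 [simp]: "rank_count w 0 q = 0"
  by (simp add: rank_count_def)

lemma rank_count_act:
  assumes "1 \<le> i" "i < j" "u i < u j"
  shows "rank_count (act u (i, j)) p q =
    rank_count u p q + (if i \<le> p \<and> p < j \<and> u i < q \<and> q \<le> u j then 1 else 0)"
proof (induction p)
  case (Suc p)
  show ?case
    using assms unfolding rank_count_Suc Suc.IH by (auto simp: not_le not_less le_Suc_eq less_Suc_eq)
qed (use assms in auto)

lemma rank_le_refl [simp]: "rank_le u u" by (simp add: rank_le_def)

lemma rank_le_trans: "rank_le u v \<Longrightarrow> rank_le v w \<Longrightarrow> rank_le u w"
  unfolding rank_le_def by (meson le_trans)

lemma rank_le_act: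
  assumes "(i, j) \<in> refls n" "u i < u j"
  shows "rank_le u (act u (i, j))"
  using assms by (auto simp: rank_le_def rank_count_act refls_def)

lemma chains_imp_rank_le:
  assumes "chain_count n R u v \<noteq> 0" "set R \<subseteq> refls n" "u permutes {1..n}"
  shows "rank_le u v"
  using assms
proof (induction R arbitrary: u)
  case (Cons r R)
  obtain i j where r: "r = (i, j)" by (cases r)
  show ?case
  proof (cases "chain_count n R u v = 0")
    case True
    then have "covers n u r" "chain_count n R (act u r) v \<noteq> 0"
      using Cons.prems(1) by (auto split: if_splits)
    then have "rank_le (act u r) v" "rank_le u (act u r)"
      using Cons covers_imp_less[of u n i j] rank_le_act[of i j n u]
      by (auto simp: act_permutes r)
    then show ?thesis using rank_le_trans by blast
  qed (use Cons in auto)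
qed (auto split: if_splits)

lemma rank_le_first_difference:
  assumes "rank_le u v" "\<And>k. 1 \<le> k \<Longrightarrow> k < m \<Longrightarrow> u k = v k" "1 \<le> m"
  shows "u m \<le> v m"
proof -
  obtain p where p: "m = Suc p" using assms(3) by (cases m) auto
  have "rank_count u p q = rank_count v p q" for q
    using assms(2) p unfolding rank_count_def by (intro arg_cong[of _ _ card]) auto
  moreover have "rank_count u m (u m) \<le> rank_count v m (u m)"
    using assms(1) by (auto simp: rank_le_def)
  ultimately show ?thesis by (simp add: p rank_count_Suc split: if_splits)
qed

text \<open>
  Only the entries with \<open>m \<le> p < j\<close> and \<open>u m < q \<le> u j\<close> grow under the exchange, so they must
  be strictly smaller than those of \<open>v\<close>. They are: above the value \<open>v m\<close> the
  ranks already compare, and among the values in \<open>[q, v m]\<close> the first \<open>p\<close> positions of \<open>u\<close> show only those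
  left of \<open>m\<close>, which \<open>v\<close> shares, whereas \<open>v\<close> also has \<open>v m\<close>.
\<close>

lemma rank_le_first_exchange:
  assumes le: "rank_le u v" and agree: "\<And>k. 1 \<le> k \<Longrightarrow> k < m \<Longrightarrow> u k = v k" and m: "1 \<le> m" "m < j"
    and j: "u m < u j" "u j \<le> v m"
    and gap: "\<And>k. m < k \<Longrightarrow> k < j \<Longrightarrow> \<not> (u m < u k \<and> u k \<le> v m)"
  shows "rank_le (act u (m, j)) v"
proof -
  have "rank_count u p q < rank_count v p q" if "m \<le> p" "p < j" "u m < q" "q \<le> u j" for p q
  proof -
    \<comment> \<open>Counting the values at least \<open>q\<close> splits at \<open>v m\<close>.\<close>
    let ?q = "Suc (v m)"
    have split: "rank_count w p q = rank_count w p ?q + card {k \<in> {1..p}. q \<le> w k \<and> w k \<le> v m}" for w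
    proof -
      have "{k \<in> {1..p}. q \<le> w k}
          = {k \<in> {1..p}. ?q \<le> w k} \<union> {k \<in> {1..p}. q \<le> w k \<and> w k \<le> v m}"
        using that j by auto
      then show ?thesis
        unfolding rank_count_def by (simp add: card_Un_disjoint disjoint_iff)
    qed
    have "{k \<in> {1..p}. q \<le> u k \<and> u k \<le> v m} \<subseteq> {k \<in> {1..p}. q \<le> v k \<and> v k \<le> v m} - {m}"
    proof
      fix k assume k: "k \<in> {k \<in> {1..p}. q \<le> u k \<and> u k \<le> v m}"
      then have "\<not> m < k" using gap[of k] that by auto
      moreover have "k \<noteq> m" using k that by auto
      ultimately have "k < m" by simp
      then show "k \<in> {k \<in> {1..p}. q \<le> v k \<and> v k \<le> v m} - {m}" using k agree[of k] by auto
    qed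
    then have "card {k \<in> {1..p}. q \<le> u k \<and> u k \<le> v m}
        \<le> card ({k \<in> {1..p}. q \<le> v k \<and> v k \<le> v m} - {m})"
      by (intro card_mono) auto
    also have "\<dots> < card {k \<in> {1..p}. q \<le> v k \<and> v k \<le> v m}"
      using that j m by (intro card_Diff1_less) auto
    finally have "card {k \<in> {1..p}. q \<le> u k \<and> u k \<le> v m}
        < card {k \<in> {1..p}. q \<le> v k \<and> v k \<le> v m}" .
    moreover have "rank_count u p ?q \<le> rank_count v p ?q"
      using le by (simp add: rank_le_def)
    ultimately show ?thesis unfolding split[of u] split[of v] by linarith
  qed
  then show ?thesis
    using le m j unfolding rank_le_def by (simp add: rank_count_act) (metis Suc_eq_plus1 Suc_leI)
qed

lemma chains_fixed_position:
  assumes "chain_count n R u v \<noteq> 0" "\<And>i j. (i, j) \<in> set R \<Longrightarrow> m \<noteq> i \<and> m \<noteq> j"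
  shows "v m = u m"
  using assms
proof (induction R arbitrary: u)
  case (Cons r R)
  obtain i j where r: "r = (i, j)" by (cases r)
  have "m \<noteq> i" "m \<noteq> j" using Cons.prems(2)[of i j] r by auto
  show ?case
  proof (cases "chain_count n R u v = 0")
    case True
    then have "chain_count n R (act u r) v \<noteq> 0"
      using Cons.prems(1) by (auto split: if_splits)
    then have "v m = act u r m" using Cons.prems(2) by (intro Cons.IH) auto
    then show ?thesis using \<open>m \<noteq> i\<close> \<open>m \<noteq> j\<close> r by simp
  next
    case False
    then show ?thesis using Cons.prems(2) by (intro Cons.IH) auto
  qed
qed (auto split: if_splits)

text \<open>
  A candidate position \<open>k\<close> that was passed over cannot be made up for: covers do not jump over the value
  \<open>u k\<close>, so position \<open>m\<close> keeps a value below \<open>u k\<close> and never reaches \<open>v m\<close>.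
\<close>

lemma sweep_chains_skipped:
  assumes "u permutes {1..n}" "1 \<le> m" "m < k" "k < j" "j \<le> Suc n" "u m < u k" "u k \<le> v m"
  shows "chain_count n (sweep m [j..<n+1] @ lex_refls (Suc m) n) u v = 0"
  using assms(5,1-4,6-7)
proof (induction j arbitrary: u rule: inc_induct)
  case base
  show ?case
  proof (rule ccontr)
    assume "chain_count n (sweep m [Suc n..<n + 1] @ lex_refls (Suc m) n) u v \<noteq> 0"
    then have "chain_count n (lex_refls (Suc m) n) u v \<noteq> 0" by simp
    then have "v m = u m" by (rule chains_fixed_position) (auto simp: set_lex_refls)
    with base show False by simp
  qed
next
  case (step j)
  have r: "(m, j) \<in> refls n" using step by (auto simp: refls_def)
  have IH: "chain_count n (sweep m [Suc j..<n+1] @ lex_refls (Suc m) n) w v = 0"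
    if "w permutes {1..n}" "w m < w k" "w k \<le> v m" for w
    using step.IH[of w] that step.prems by simp
  have "chain_count n (sweep m [Suc j..<n+1] @ lex_refls (Suc m) n) (act u (m, j)) v = 0"
    if c: "covers n u (m, j)"
  proof (rule IH)
    show "act u (m, j) permutes {1..n}" using r step by (intro act_permutes)
    have "\<not> (u m < u k \<and> u k < u j)"
      using covers_no_between[OF _ r c, of k] step by simp
    moreover have "u k \<noteq> u j"
      using step by (simp add: inj_eq[OF permutes_inj[OF \<open>u permutes {1..n}\<close>]])
    ultimately show "act u (m, j) m < act u (m, j) k" using step by simp
    show "act u (m, j) k \<le> v m" using step by simp
  qed
  moreover have "chain_count n (sweep m [Suc j..<n+1] @ lex_refls (Suc m) n) u v = 0"
    using step by (intro IH) auto
  ultimately show ?case using step.hyps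
    by (simp add: upt_conv_Cons del: upt_Suc)
qed

text \<open>
  The greedy chain is the only one: position \<open>m\<close> must take the first value to its right
  that is larger than its own but not larger than \<open>v m\<close>. Skipping it is fatal, and taking a
  value beyond \<open>v m\<close> leaves the elements below \<open>v\<close>. When the sweep is over, position \<open>m\<close>
  has the value \<open>v m\<close>.
\<close>

lemma sweep_chains_unique:
  assumes m: "1 \<le> m" "m \<le> n" and v: "v permutes {1..n}"
    and tail: "\<And>w. w permutes {1..n} \<Longrightarrow> rank_le w v \<Longrightarrow>
        (\<And>k. 1 \<le> k \<Longrightarrow> k < Suc m \<Longrightarrow> w k = v k) \<Longrightarrow> chain_count n (lex_refls (Suc m) n) w v = 1"
    and "m < j" "j \<le> Suc n" "u permutes {1..n}" "rank_le u v"
      "\<And>k. 1 \<le> k \<Longrightarrow> k < m \<Longrightarrow> u k = v k"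
      "\<And>k. m < k \<Longrightarrow> k < j \<Longrightarrow> \<not> (u m < u k \<and> u k \<le> v m)"
  shows "chain_count n (sweep m [j..<n+1] @ lex_refls (Suc m) n) u v = 1"
  using assms(6,5,7-10)
proof (induction j arbitrary: u rule: inc_induct)
  case base
  note u = base.prems(2) and le = base.prems(3) and agree = base.prems(4) and gap = base.prems(5)
  have "v m \<in> {1..n}" using permutes_in_image[OF v] m by simp
  then obtain k where k: "k \<in> {1..n}" "u k = v m"
    using permutes_image[OF u] by (metis imageE)
  have lem: "u m \<le> v m"
    by (rule rank_le_first_difference[OF le agree m(1)])
  have "\<not> k < m"
  proof
    assume "k < m"
    then have "v k = v m" using agree[of k] k by simp
    with \<open>k < m\<close> show False by (simp add: inj_eq[OF permutes_inj[OF v]])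
  qed
  moreover have "\<not> m < k"
  proof
    assume "m < k"
    moreover from this have "u m \<noteq> u k" by (simp add: inj_eq[OF permutes_inj[OF u]])
    ultimately show False using gap[of k] k lem by simp
  qed
  ultimately have "u m = v m" using k by (metis linorder_neqE_nat)
  then have "chain_count n (lex_refls (Suc m) n) u v = 1"
    using agree by (intro tail u le) (auto simp: less_Suc_eq)
  then show ?case by simp
next
  case (step j)
  note u = step.prems(2) and le = step.prems(3) and agree = step.prems(4) and gap = step.prems(5)
  have j: "m < j" "j \<le> n" using step.hyps step.prems(1) by auto
  let ?R = "sweep m [Suc j..<n+1] @ lex_refls (Suc m) n"
  have r: "(m, j) \<in> refls n" using j m by (auto simp: refls_def)
  have act: "act u (m, j) permutes {1..n}" by (rule act_permutes[OF u r])
  have eq: "chain_count n (sweep m [j..<n+1] @ lex_refls (Suc m) n) u v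
     = chain_count n ?R u v + (if covers n u (m, j) then chain_count n ?R (act u (m, j)) v else 0)"
    using j by (simp add: upt_conv_Cons del: upt_Suc)
  have sub: "set ?R \<subseteq> refls n" using m j
    by (auto simp: set_lex_refls refls_def)
  show ?case
  proof (cases "u m < u j \<and> u j \<le> v m")
    case True
    have "u k < u m \<or> u j < u k" if "m < k" "k < j" for k
    proof -
      have "u k \<noteq> u m" "u k \<noteq> u j"
        using that by (simp_all add: inj_eq[OF permutes_inj[OF u]])
      then show ?thesis using gap[OF that] True by linarith
    qed
    then have "covers n u (m, j)" using r True by (intro coversI) auto
    moreover have "chain_count n ?R u v = 0"
      using True j m by (intro sweep_chains_skipped[OF u, of _ j]) auto
    moreover have "chain_count n ?R (act u (m, j)) v = 1"
    proof (rule step.IH[OF _ act])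
      show "m < Suc j" using j by simp
      show "rank_le (act u (m, j)) v"
        using True by (intro rank_le_first_exchange[OF le agree m(1) j(1) _ _ gap]) auto
      show "act u (m, j) k = v k" if "1 \<le> k" "k < m" for k
        using that agree[of k] j by simp
      show "\<not> (act u (m, j) m < act u (m, j) k \<and> act u (m, j) k \<le> v m)"
        if "m < k" "k < Suc j" for k
        using that gap[of k] True by (cases "k = j") auto
    qed
    ultimately show ?thesis unfolding eq by simp
  next
    case False
    have gap': "\<not> (u m < u k \<and> u k \<le> v m)" if "m < k" "k < Suc j" for k
      using that gap[of k] False by (cases "k = j") auto
    have "chain_count n ?R u v = 1"
      by (rule step.IH[OF _ u le agree gap']) (use j in auto)
    moreover have "chain_count n ?R (act u (m, j)) v = 0" if c: "covers n u (m, j)"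
    proof (rule ccontr)
      assume "chain_count n ?R (act u (m, j)) v \<noteq> 0"
      then have le': "rank_le (act u (m, j)) v"
        by (rule chains_imp_rank_le[OF _ sub act])
      have "act u (m, j) k = v k" if "1 \<le> k" "k < m" for k
        using that agree[of k] j by simp
      then have "act u (m, j) m \<le> v m"
        by (rule rank_le_first_difference[OF le' _ m(1)])
      moreover have "u m < u j" using covers_imp_less[OF u r c] .
      ultimately show False using False by simp
    qed
    ultimately show ?thesis unfolding eq by simp
  qed
qed

text \<open>
  This is the statement on increasing chains in Edelman's theorem that the lexicographic order of the
  transpositions gives an EL-labelling of the Bruhat order. The positions are settled from left to right, one
  sweep for each, and the positions before \<open>m\<close> are those settled already.
\<close>

lemma lex_chains_unique:
  assumes "u permutes {1..n}" "v permutes {1..n}" "rank_le u v" "1 \<le> m" "m \<le> Suc n"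
    "\<And>k. 1 \<le> k \<Longrightarrow> k < m \<Longrightarrow> u k = v k"
  shows "chain_count n (lex_refls m n) u v = 1"
  using assms(5,1-4,6)
proof (induction m arbitrary: u rule: inc_induct)
  case base
  have "u k = v k" for k
    using base.prems(5)[of k] permutes_not_in[OF base.prems(1), of k]
      permutes_not_in[OF base.prems(2), of k]
    by (cases "k \<in> {1..n}") auto
  then have "u = v" by blast
  then show ?case by (simp add: lex_refls_empty)
next
  case (step m)
  note v = step.prems(2)
  have m: "1 \<le> m" "m \<le> n" using step.hyps step.prems(4) by auto
  have tail: "chain_count n (lex_refls (Suc m) n) w v = 1"
    if "w permutes {1..n}" "rank_le w v" "\<And>k. 1 \<le> k \<Longrightarrow> k < Suc m \<Longrightarrow> w k = v k" for w
    by (rule step.IH[OF that(1) v that(2) _ that(3)]) simp_all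
  have "chain_count n (sweep m [Suc m..<n+1] @ lex_refls (Suc m) n) u v = 1"
    by (rule sweep_chains_unique[OF m v tail _ _ step.prems(1,3,5)]) (use m in auto)
  then show ?case using lex_refls_unfold[OF m(2)] by simp
qed

lemma bruhat_step_iff:
  assumes "u permutes {1..n}"
  shows "bruhat_step n u v \<longleftrightarrow> (\<exists>i j. (i, j) \<in> refls n \<and> u i < u j \<and> v = act u (i, j))"
proof
  assume "bruhat_step n u v"
  then obtain i j where ij: "i \<in> {1..n}" "j \<in> {1..n}" "i \<noteq> j"
    and v: "v = u \<circ> Transposition.transpose i j" "perm_length n u < perm_length n v"
    by (auto simp: bruhat_step_def)
  show "\<exists>i j. (i, j) \<in> refls n \<and> u i < u j \<and> v = act u (i, j)"
  proof (cases "i < j")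
    case True
    then have "(i, j) \<in> refls n" "v = act u (i, j)" using ij v by (auto simp: refls_def act_def)
    then show ?thesis using v length_act_less_iff[OF assms, of i j] by blast
  next
    case False
    then have "(j, i) \<in> refls n" "v = act u (j, i)" 
      using ij v by (auto simp: refls_def act_def transpose_commute)
    then show ?thesis using v length_act_less_iff[OF assms, of j i] by blast
  qed
next
  assume "\<exists>i j. (i, j) \<in> refls n \<and> u i < u j \<and> v = act u (i, j)"
  then obtain i j where *: "(i, j) \<in> refls n" "u i < u j" "v = act u (i, j)" by blast
  then show "bruhat_step n u v"
    unfolding bruhat_step_def using length_act_less[OF *(1,2)]
    by (intro bexI[of _ i] bexI[of _ j]) (auto simp: refls_def act_def)
qed

lemma bruhat_le_act:
  assumes "u permutes {1..n}" "(i, j) \<in> refls n" "u i < u j"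
  shows "bruhat_le n u (act u (i, j))"
  using assms bruhat_step_iff[OF assms(1)] act_permutes
  by (auto simp: bruhat_le_def)

lemma bruhat_le_refl: "u permutes {1..n} \<Longrightarrow> bruhat_le n u u"
  by (simp add: bruhat_le_def)

lemma bruhat_le_trans: "bruhat_le n u v \<Longrightarrow> bruhat_le n v w \<Longrightarrow> bruhat_le n u w"
  by (auto simp: bruhat_le_def)

lemma bruhat_le_imp_rank_le:
  assumes "bruhat_le n u v"
  shows "rank_le u v"
proof -
  have "(bruhat_step n)\<^sup>*\<^sup>* u v" "u permutes {1..n}" using assms by (auto simp: bruhat_le_def)
  then have "v permutes {1..n} \<and> rank_le u v"
  proof (induction rule: rtranclp_induct)
    case (step y z)
    then obtain i j where "(i, j) \<in> refls n" "y i < y j" "z = act y (i, j)"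
      using bruhat_step_iff by blast
    then show ?case using step rank_le_act rank_le_trans act_permutes by metis
  qed auto
  then show ?thesis by blast
qed

lemma chains_imp_bruhat_le:
  assumes "chain_count n R u v \<noteq> 0" "set R \<subseteq> refls n" "u permutes {1..n}"
  shows "bruhat_le n u v"
  using assms
proof (induction R arbitrary: u)
  case (Cons r R)
  obtain i j where r: "r = (i, j)" by (cases r)
  show ?case
  proof (cases "chain_count n R u v = 0")
    case True
    then have "covers n u r" "chain_count n R (act u r) v \<noteq> 0"
      using Cons.prems(1) by (auto split: if_splits)
    then have "bruhat_le n (act u r) v" "bruhat_le n u (act u r)"
      using Cons covers_imp_less[of u n i j] bruhat_le_act[of u n i j]
      by (auto simp: act_permutes r)
    then show ?thesis using bruhat_le_trans by blast
  qed (use Cons in auto)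
qed (auto split: if_splits simp: bruhat_le_refl)

section \<open>Turning points of increasing chains\<close>

lemma chains_self: "chain_count n R u u \<noteq> 0"
  by (induction R) auto

lemma chains_filter_le: "chain_count n (filter P R) u v \<le> chain_count n R u v"
proof (induction R arbitrary: u)
  case (Cons r R)
  show ?case using Cons[of u] Cons[of "act u r"] by (auto intro: trans_le_add1)
qed simp

lemma covers_bruhat_le:
  assumes "u permutes {1..n}" "r \<in> refls n" "covers n u r"
  shows "bruhat_le n u (act u r)"
  using assms covers_imp_less bruhat_le_act by (cases r) blast

lemma chains_last_step:
  assumes "chain_count n R u z \<noteq> 0" "u \<noteq> z" "u permutes {1..n}" "set R \<subseteq> refls n"
  shows "\<exists>r\<in>set R. \<exists>y. bruhat_le n u y \<and> covers n y r \<and> act y r = z"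
  using assms
proof (induction R arbitrary: u)
  case (Cons r R)
  show ?case
  proof (cases "chain_count n R u z = 0 \<and> act u r = z")
    case True
    then have "covers n u r" using Cons.prems(1) by (auto split: if_splits)
    then show ?thesis using True Cons.prems(3) bruhat_le_refl by auto
  next
    case False
    show ?thesis
    proof (cases "chain_count n R u z = 0")
      case True
      then have c: "covers n u r" "chain_count n R (act u r) z \<noteq> 0"
        using Cons.prems(1) by (auto split: if_splits)
      obtain s y where "s \<in> set R" "bruhat_le n (act u r) y" "covers n y s" "act y s = z"
        using Cons.IH[OF c(2)] False True Cons.prems(3,4) act_permutes by auto
      moreover have "bruhat_le n u (act u r)"
        using Cons.prems c by (intro covers_bruhat_le) auto
      ultimately show ?thesis using bruhat_le_trans by (metis list.set_intros(2))
    next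
      case False
      then show ?thesis using Cons by auto
    qed
  qed
qed simp

lemma chains_first_step:
  assumes "chain_count n R z v \<noteq> 0" "z \<noteq> v" "z permutes {1..n}" "set R \<subseteq> refls n"
  shows "\<exists>r\<in>set R. covers n z r \<and> bruhat_le n (act z r) v"
  using assms
proof (induction R)
  case (Cons r R)
  show ?case
  proof (cases "chain_count n R z v = 0")
    case True
    then have c: "covers n z r" "chain_count n R (act z r) v \<noteq> 0"
      using Cons.prems(1) by (auto split: if_splits)
    then have "bruhat_le n (act z r) v"
      using Cons.prems by (intro chains_imp_bruhat_le[OF c(2)] act_permutes) auto
    then show ?thesis using c by auto
  qed (use Cons in auto)
qed simp

text \<open>
  Braid moves preserve the number of chains, so uniqueness carries over from the lexicographic
  order to every reflection order.
\<close>

lemma chains_reflection_order: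
  assumes "lex_refls 1 n \<asymp> R" "bruhat_le n u v"
  shows "chain_count n R u v = 1"
proof -
  have "chain_count n (lex_refls 1 n) u v = 1"
    using assms(2) bruhat_le_imp_rank_le[OF assms(2)]
    by (intro lex_chains_unique) (auto simp: bruhat_le_def)
  moreover have "set (lex_refls 1 n) \<subseteq> refls n" by (auto simp: set_lex_refls refls_def)
  ultimately show ?thesis
    using braid_chains[OF assms(1)] assms(2) by (simp add: bruhat_le_def)
qed

lemma set_reflection_order:
  assumes "lex_refls 1 n \<asymp> R"
  shows "set R = refls n"
  using braid_set[OF assms] by (auto simp: set_lex_refls refls_def)

lemma chains_split:
  assumes "chain_count n (A @ B) u v \<noteq> 0" "u permutes {1..n}" "set A \<subseteq> refls n"
  obtains z where "z permutes {1..n}" "chain_count n A u z \<noteq> 0" "chain_count n B z v \<noteq> 0"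
proof -
  have "(\<Sum>z | z permutes {1..n}. chain_count n A u z * chain_count n B z v) \<noteq> 0"
    using assms chains_append by metis
  then obtain z where "z \<in> {z. z permutes {1..n}}" "chain_count n A u z * chain_count n B z v \<noteq> 0"
    by (rule sum.not_neutral_contains_not_neutral)
  then show ?thesis using that by auto
qed

text \<open>
  Counting the increasing chains by the element at which they pass from labels in \<open>A\<close> to
  labels in \<open>B\<close> gives the sum \<open>1\<close>, so only one element can contribute.
\<close>

lemma turning_point_unique:
  assumes order: "lex_refls 1 n \<asymp> A @ B" and uv: "bruhat_le n u v"
    and z: "chain_count n A u z \<noteq> 0" "chain_count n B z v \<noteq> 0"
    and z': "chain_count n A u z' \<noteq> 0" "chain_count n B z' v \<noteq> 0"
  shows "z = z'"
proof (rule ccontr)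
  assume ne: "z \<noteq> z'"
  let ?f = "\<lambda>z. chain_count n A u z * chain_count n B z v"
  have u: "u permutes {1..n}" using uv by (simp add: bruhat_le_def)
  have A: "set A \<subseteq> refls n" using set_reflection_order[OF order] by auto
  have "z permutes {1..n}" "z' permutes {1..n}"
    using chains_imp_bruhat_le[OF z(1) A u] chains_imp_bruhat_le[OF z'(1) A u]
    by (simp_all add: bruhat_le_def)
  then have "sum ?f {z, z'} \<le> sum ?f {z. z permutes {1..n}}"
    by (intro sum_mono2 finite_permutations) auto
  also have "\<dots> = 1"
    using chains_append[OF u A, of B v] chains_reflection_order[OF order uv] by simp
  finally have "?f z + ?f z' \<le> 1" using ne by simp
  moreover have "?f z > 0" "?f z' > 0" using z z' by auto
  ultimately show False by linarith
qed

text \<open>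
  Think of \<open>A\<close> as the labels whose upward steps are improvements and of \<open>B\<close> as those
  whose downward steps are. If \<open>z\<close> cannot be improved inside \<open>[u, v]\<close>, then the increasing
  chain from \<open>u\<close> to \<open>z\<close> cannot end with a label in \<open>B\<close> and the one from \<open>z\<close> to \<open>v\<close> cannot start
  with a label in \<open>A\<close>. Since the labels of \<open>A\<close> come first, the first chain lies in \<open>A\<close> and
  the second in \<open>B\<close>. Together with the uniqueness of turning points this says that a local
  maximum on a Bruhat interval is unique.
\<close>

lemma local_maximum_is_turning_point:
  assumes order: "lex_refls 1 n \<asymp> A @ B" and z: "bruhat_le n u z" "bruhat_le n z v"
    and up: "\<And>r. r \<in> set A \<Longrightarrow> covers n z r \<Longrightarrow> \<not> bruhat_le n (act z r) v"
    and down: "\<And>r y. r \<in> set B \<Longrightarrow> covers n y r \<Longrightarrow> act y r = z \<Longrightarrow> \<not> bruhat_le n u y"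
  shows "chain_count n A u z \<noteq> 0 \<and> chain_count n B z v \<noteq> 0"
proof -
  have p: "u permutes {1..n}" "z permutes {1..n}" using z by (simp_all add: bruhat_le_def)
  have AB: "set A \<subseteq> refls n" "set B \<subseteq> refls n" using set_reflection_order[OF order] by auto
  obtain y where y: "y permutes {1..n}" "chain_count n A u y \<noteq> 0" "chain_count n B y z \<noteq> 0"
    using chains_split[of n A B u z] chains_reflection_order[OF order z(1)] p AB by auto
  have "y = z"
  proof (rule ccontr)
    assume "y \<noteq> z"
    then obtain r x where "r \<in> set B" "bruhat_le n y x" "covers n x r" "act x r = z"
      using chains_last_step[OF y(3) _ y(1) AB(2)] by blast
    moreover have "bruhat_le n u y" using chains_imp_bruhat_le[OF y(2) AB(1) p(1)] .
    ultimately show False using down bruhat_le_trans by blast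
  qed
  obtain y' where y': "y' permutes {1..n}" "chain_count n A z y' \<noteq> 0" "chain_count n B y' v \<noteq> 0"
    using chains_split[of n A B z v] chains_reflection_order[OF order z(2)] p AB by auto
  have "y' = z"
  proof (rule ccontr)
    assume "y' \<noteq> z"
    then obtain r where "r \<in> set A" "covers n z r" "bruhat_le n (act z r) y'"
      using chains_first_step[OF y'(2) _ p(2) AB(1)] by blast
    moreover have "bruhat_le n y' v" using chains_imp_bruhat_le[OF y'(3) AB(2) y'(1)] .
    ultimately show False using up bruhat_le_trans by blast
  qed
  with \<open>y = z\<close> y y' show ?thesis by simp
qed

section \<open>Maximizers of a linear functional on a Bruhat interval\<close>

definition weight :: "nat \<Rightarrow> (nat \<Rightarrow> real) \<Rightarrow> (nat \<Rightarrow> nat) \<Rightarrow> real" where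
  "weight n w z = (\<Sum>k = 1..n. w k * real (z k))"

lemma weight_act:
  assumes "(i, j) \<in> refls n"
  shows "weight n w (act z (i, j)) = weight n w z + (w i - w j) * (real (z j) - real (z i))"
proof -
  have ij: "i \<in> {1..n}" "j \<in> {1..n} - {i}" using assms by (auto simp: refls_def)
  have split: "(\<Sum>k = 1..n. f k) = f i + (f j + (\<Sum>k \<in> {1..n} - {i} - {j}. f k))" for f :: "nat \<Rightarrow> real"
    using sum.remove[OF _ ij(1), of f] sum.remove[OF _ ij(2), of f] by simp
  have "(\<Sum>k \<in> {1..n} - {i} - {j}. w k * real (act z (i, j) k))
      = (\<Sum>k \<in> {1..n} - {i} - {j}. w k * real (z k))"
    by (intro sum.cong) auto
  then show ?thesis
    using ij unfolding weight_def split by (simp add: algebra_simps)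
qed

definition maximizers :: "nat \<Rightarrow> (nat \<Rightarrow> real) \<Rightarrow> (nat \<Rightarrow> nat) \<Rightarrow> (nat \<Rightarrow> nat) \<Rightarrow> (nat \<Rightarrow> nat) set" where
  "maximizers n w u v = {z. bruhat_le n u z \<and> bruhat_le n z v \<and>
     (\<forall>y. bruhat_le n u y \<longrightarrow> bruhat_le n y v \<longrightarrow> weight n w y \<le> weight n w z)}"

lemma maximizersD:
  assumes "z \<in> maximizers n w u v"
  shows "bruhat_le n u z" "bruhat_le n z v" "z permutes {1..n}"
    "\<And>y. bruhat_le n u y \<Longrightarrow> bruhat_le n y v \<Longrightarrow> weight n w y \<le> weight n w z"
  using assms by (auto simp: maximizers_def bruhat_le_def)

lemma maximizersI:
  assumes "z \<in> maximizers n w u v" "bruhat_le n u y" "bruhat_le n y v" "weight n w z \<le> weight n w y"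
  shows "y \<in> maximizers n w u v"
  using assms by (auto simp: maximizers_def intro: order_trans)

lemma finite_bruhat_interval: "finite {z. bruhat_le n u z \<and> bruhat_le n z v}"
  by (rule finite_subset[OF _ finite_permutations[of "{1..n}"]]) (auto simp: bruhat_le_def)

lemma maximizers_nonempty:
  assumes "bruhat_le n u v"
  shows "maximizers n w u v \<noteq> {}"
proof -
  let ?X = "{z. bruhat_le n u z \<and> bruhat_le n z v}"
  have "u permutes {1..n}" using assms by (simp add: bruhat_le_def)
  then have "u \<in> ?X" using assms bruhat_le_refl by blast
  then have X: "finite ?X" "?X \<noteq> {}" using finite_bruhat_interval by blast+
  then have "Max (weight n w ` ?X) \<in> weight n w ` ?X" by (intro Max_in) auto
  then obtain z where z: "z \<in> ?X" "weight n w z = Max (weight n w ` ?X)" by auto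
  then have "weight n w y \<le> weight n w z" if "y \<in> ?X" for y
    using that X by (auto intro: Max_ge)
  then show ?thesis using z(1) by (auto simp: maximizers_def)
qed

lemma bruhat_le_length:
  assumes "bruhat_le n u v" "u \<noteq> v"
  shows "perm_length n u < perm_length n v"
proof -
  have "(bruhat_step n)\<^sup>*\<^sup>* u v" using assms(1) by (simp add: bruhat_le_def)
  then have "u = v \<or> perm_length n u < perm_length n v"
    by (induction rule: rtranclp_induct) (auto simp: bruhat_step_def)
  then show ?thesis using assms(2) by simp
qed

lemma above_maximal:
  assumes "z \<in> M" "finite M" "M \<subseteq> {z. z permutes {1..n}}"
  obtains y where "y \<in> M" "bruhat_le n z y" "\<And>x. x \<in> M \<Longrightarrow> bruhat_le n y x \<Longrightarrow> x = y"
proof -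
  let ?S = "{y \<in> M. bruhat_le n z y}"
  have S: "finite ?S" "?S \<noteq> {}" using assms bruhat_le_refl by auto
  then have "Max (perm_length n ` ?S) \<in> perm_length n ` ?S" by (intro Max_in) auto
  then obtain y where y: "y \<in> ?S" "perm_length n y = Max (perm_length n ` ?S)" by auto
  show ?thesis
  proof (rule that[of y])
    fix x assume x: "x \<in> M" "bruhat_le n y x"
    then have "x \<in> ?S" using y bruhat_le_trans by blast
    then have "perm_length n x \<le> perm_length n y" using y(2) S by auto
    then show "x = y" using bruhat_le_length[OF x(2)] by auto
  qed (use y in auto)
qed

lemma below_minimal:
  assumes "z \<in> M" "finite M" "M \<subseteq> {z. z permutes {1..n}}"
  obtains y where "y \<in> M" "bruhat_le n y z" "\<And>x. x \<in> M \<Longrightarrow> bruhat_le n x y \<Longrightarrow> x = y"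
proof -
  let ?S = "{y \<in> M. bruhat_le n y z}"
  have S: "finite ?S" "?S \<noteq> {}" using assms bruhat_le_refl by auto
  then have "Min (perm_length n ` ?S) \<in> perm_length n ` ?S" by (intro Min_in) auto
  then obtain y where y: "y \<in> ?S" "perm_length n y = Min (perm_length n ` ?S)" by auto
  show ?thesis
  proof (rule that[of y])
    fix x assume x: "x \<in> M" "bruhat_le n x y"
    then have "x \<in> ?S" using y bruhat_le_trans by blast
    then have "perm_length n y \<le> perm_length n x" using y(2) S by auto
    then show "x = y" using bruhat_le_length[OF x(2)] by auto
  qed (use y in auto)
qed

lemma maximizers_finite: "finite (maximizers n w u v)" "maximizers n w u v \<subseteq> {z. z permutes {1..n}}"
  using finite_subset[OF _ finite_bruhat_interval[of n u v], of "maximizers n w u v"]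
  by (auto simp: maximizers_def bruhat_le_def)

lemma reflection_order_exists:
  assumes "transp P" "asymp P" "totalp P"
  obtains A B where "lex_refls 1 n \<asymp> A @ B"
    "set A = {(p, q). (p, q) \<in> refls n \<and> P q p}" "set B = {(p, q). (p, q) \<in> refls n \<and> P p q}"
proof -
  obtain A B where "lex_refls 1 n \<asymp> A @ B"
    "set A = {(p, q). 1 \<le> p \<and> p < q \<and> q \<le> n \<and> P q p}"
    "set B = {(p, q). 1 \<le> p \<and> p < q \<and> q \<le> n \<and> P p q}"
    using lex_refls_braid_section[OF assms, of 1 n] by auto
  then show ?thesis by (intro that) (auto simp: refls_def)
qed

text \<open>
  Sorting the positions by \<open>w\<close> leaves the choice how to order positions with equal values of \<open>w\<close>.
  Increasing order puts the neutral labels into \<open>B\<close>, so that moving down along a neutral label counts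
  as an improvement; decreasing order, used in the next lemma, puts them into \<open>A\<close>.
\<close>

lemma strict_ascents_first:
  fixes w :: "nat \<Rightarrow> real"
  obtains A B where "lex_refls 1 n \<asymp> A @ B"
    "set A = {(p, q). (p, q) \<in> refls n \<and> w q < w p}" "set B = {(p, q). (p, q) \<in> refls n \<and> w p \<le> w q}"
proof -
  let ?P = "\<lambda>a b. w a < w b \<or> (w a = w b \<and> a < b)"
  obtain A B where *: "lex_refls 1 n \<asymp> A @ B"
    "set A = {(p, q). (p, q) \<in> refls n \<and> ?P q p}" "set B = {(p, q). (p, q) \<in> refls n \<and> ?P p q}"
    by (rule reflection_order_exists[of ?P n])
       (auto simp: transp_def asymp_on_def totalp_on_def intro: that)
  show ?thesis by (rule that[OF *(1)]) (auto simp: *(2,3) refls_def)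
qed

lemma weak_ascents_first:
  fixes w :: "nat \<Rightarrow> real"
  obtains A B where "lex_refls 1 n \<asymp> A @ B"
    "set A = {(p, q). (p, q) \<in> refls n \<and> w q \<le> w p}" "set B = {(p, q). (p, q) \<in> refls n \<and> w p < w q}"
proof -
  let ?P = "\<lambda>a b. w a < w b \<or> (w a = w b \<and> b < a)"
  obtain A B where *: "lex_refls 1 n \<asymp> A @ B"
    "set A = {(p, q). (p, q) \<in> refls n \<and> ?P q p}" "set B = {(p, q). (p, q) \<in> refls n \<and> ?P p q}"
    by (rule reflection_order_exists[of ?P n])
       (auto simp: transp_def asymp_on_def totalp_on_def intro: that)
  show ?thesis by (rule that[OF *(1)]) (auto simp: *(2,3) refls_def)
qed

lemma weight_covers:
  assumes "z permutes {1..n}" "(p, q) \<in> refls n" "covers n z (p, q)"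
  shows "w q < w p \<Longrightarrow> weight n w z < weight n w (act z (p, q))"
    "w q \<le> w p \<Longrightarrow> weight n w z \<le> weight n w (act z (p, q))"
    "w p < w q \<Longrightarrow> weight n w (act z (p, q)) < weight n w z"
    "w p \<le> w q \<Longrightarrow> weight n w (act z (p, q)) \<le> weight n w z"
  using covers_imp_less[OF assms] weight_act[OF assms(2), of w z]
  by (auto simp: mult_pos_pos mult_neg_pos mult_nonneg_nonneg mult_nonpos_nonneg)

lemma minimal_maximizer_is_turning_point:
  assumes order: "lex_refls 1 n \<asymp> A @ B"
    and A: "set A = {(p, q). (p, q) \<in> refls n \<and> w q < w p}"
    and B: "set B = {(p, q). (p, q) \<in> refls n \<and> w p \<le> w q}"
    and z: "z \<in> maximizers n w u v"
    and minimal: "\<And>y. y \<in> maximizers n w u v \<Longrightarrow> bruhat_le n y z \<Longrightarrow> y = z"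
  shows "chain_count n A u z \<noteq> 0 \<and> chain_count n B z v \<noteq> 0"
proof (rule local_maximum_is_turning_point[OF order maximizersD(1,2)[OF z]])
  fix r assume r: "r \<in> set A" "covers n z r"
  then have "bruhat_le n z (act z r)" "weight n w z < weight n w (act z r)"
    using maximizersD(3)[OF z] A covers_bruhat_le weight_covers(1) by auto
  then show "\<not> bruhat_le n (act z r) v"
    using maximizersD(1,4)[OF z] bruhat_le_trans by (meson not_le)
next
  fix r y assume r: "r \<in> set B" "covers n y r" "act y r = z"
  show "\<not> bruhat_le n u y"
  proof
    assume u: "bruhat_le n u y"
    then have y: "y permutes {1..n}" by (simp add: bruhat_le_def)
    have le: "bruhat_le n y z" "weight n w z \<le> weight n w y"
      using y r B covers_bruhat_le[OF y, of r] weight_covers(4)[OF y] by auto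
    then have "y \<in> maximizers n w u v"
      using z u maximizersD(2)[OF z] bruhat_le_trans by (blast intro: maximizersI)
    then have "y = z" using minimal le by blast
    then show False using r by (simp add: covers_def)
  qed
qed

lemma maximal_maximizer_is_turning_point:
  assumes order: "lex_refls 1 n \<asymp> A @ B"
    and A: "set A = {(p, q). (p, q) \<in> refls n \<and> w q \<le> w p}"
    and B: "set B = {(p, q). (p, q) \<in> refls n \<and> w p < w q}"
    and z: "z \<in> maximizers n w u v"
    and maximal: "\<And>y. y \<in> maximizers n w u v \<Longrightarrow> bruhat_le n z y \<Longrightarrow> y = z"
  shows "chain_count n A u z \<noteq> 0 \<and> chain_count n B z v \<noteq> 0"
proof (rule local_maximum_is_turning_point[OF order maximizersD(1,2)[OF z]])
  fix r assume r: "r \<in> set A" "covers n z r"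
  have le: "bruhat_le n z (act z r)" "weight n w z \<le> weight n w (act z r)"
    using maximizersD(3)[OF z] A r covers_bruhat_le weight_covers(2) by auto
  show "\<not> bruhat_le n (act z r) v"
  proof
    assume "bruhat_le n (act z r) v"
    then have "act z r \<in> maximizers n w u v"
      using z le maximizersD(1)[OF z] bruhat_le_trans by (blast intro: maximizersI)
    then have "act z r = z" using maximal le by blast
    then show False using r by (simp add: covers_def)
  qed
next
  fix r y assume r: "r \<in> set B" "covers n y r" "act y r = z"
  show "\<not> bruhat_le n u y"
  proof
    assume u: "bruhat_le n u y"
    then have y: "y permutes {1..n}" by (simp add: bruhat_le_def)
    have "bruhat_le n y z" "weight n w z < weight n w y"
      using y r B covers_bruhat_le[OF y, of r] weight_covers(3)[OF y] by auto
    then show False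
      using maximizersD(2,4)[OF z] u bruhat_le_trans by (meson not_le)
  qed
qed

text \<open>
  If no step increases the functional, then equal values at both ends force every step to be neutral.
\<close>

lemma chains_weight_level:
  assumes "set R \<subseteq> {(p, q). (p, q) \<in> refls n \<and> w p \<le> w q}" "x permutes {1..n}"
    "chain_count n R x v \<noteq> 0"
  shows "weight n w v \<le> weight n w x"
    "weight n w v = weight n w x \<Longrightarrow> chain_count n (filter (\<lambda>(p, q). w p = w q) R) x v \<noteq> 0"
proof -
  have "weight n w v \<le> weight n w x \<and>
    (weight n w v = weight n w x \<longrightarrow> chain_count n (filter (\<lambda>(p, q). w p = w q) R) x v \<noteq> 0)"
    using assms
  proof (induction R arbitrary: x)
    case (Cons r R)
    obtain p q where r: "r = (p, q)" by (cases r)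
    have pq: "(p, q) \<in> refls n" "w p \<le> w q" using Cons.prems(1) r by auto
    show ?case
    proof (cases "chain_count n R x v = 0")
      case True
      then have c: "covers n x (p, q)" "chain_count n R (act x (p, q)) v \<noteq> 0"
        using Cons.prems(3) r by (auto split: if_splits)
      have le: "weight n w (act x (p, q)) \<le> weight n w x"
        using weight_covers(4)[OF Cons.prems(2) pq(1) c(1)] pq by auto
      have sub: "set R \<subseteq> {(p, q). (p, q) \<in> refls n \<and> w p \<le> w q}"
        using Cons.prems(1) by simp
      note IH = Cons.IH[OF sub act_permutes[OF Cons.prems(2) pq(1)] c(2)]
      have IH1: "weight n w v \<le> weight n w (act x (p, q))"
        by (rule conjunct1[OF IH])
      have IH2: "weight n w v = weight n w (act x (p, q)) \<longrightarrow>
          chain_count n (filter (\<lambda>(p, q). w p = w q) R) (act x (p, q)) v \<noteq> 0"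
        by (rule conjunct2[OF IH])
      show ?thesis
      proof (intro conjI impI)
        show "weight n w v \<le> weight n w x" using le IH1 by linarith
        assume eq: "weight n w v = weight n w x"
        then have "weight n w v = weight n w (act x (p, q))" using le IH1 by linarith
        moreover from this eq have "w p = w q"
          using weight_covers(3)[OF Cons.prems(2) pq(1) c(1), of w] pq by force
        ultimately show "chain_count n (filter (\<lambda>(p, q). w p = w q) (r # R)) x v \<noteq> 0"
          using IH2 c by (simp add: r)
      qed
    next
      case False
      then have "weight n w v \<le> weight n w x"
        "weight n w v = weight n w x \<Longrightarrow> chain_count n (filter (\<lambda>(p, q). w p = w q) R) x v \<noteq> 0"
        using Cons by auto
      then show ?thesis by auto
    qed
  qed (auto split: if_splits)
  then show "weight n w v \<le> weight n w x"
    "weight n w v = weight n w x \<Longrightarrow> chain_count n (filter (\<lambda>(p, q). w p = w q) R) x v \<noteq> 0"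
    by auto
qed

text \<open>
  Since \<open>u\<close> is a maximizer, the increasing chain from \<open>u\<close> to \<open>v\<close> for the order adapted to \<open>w\<close> has no
  improving first step, hence no improving step at all, and all its labels are neutral
  because \<open>v\<close> has the same weight. The restrictions of any two reflection orders to the neutral labels are
  equivalent, so there is also a chain of neutral labels that is increasing for the order adapted to \<open>- w\<close>. In
  that order, neutral labels belong to the second part, so \<open>u\<close> is its
  turning point. But the turning point is a minimizer of \<open>w\<close>. Hence the minimum on the interval
  equals the maximum.
\<close>

lemma weight_constant:
  assumes uv: "bruhat_le n u v" and M: "u \<in> maximizers n w u v" "v \<in> maximizers n w u v"
    and y: "bruhat_le n u y" "bruhat_le n y v"
  shows "weight n w y = weight n w u"
proof -
  let ?lev = "\<lambda>(p, q). w p = w q"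
  have u: "u permutes {1..n}" using uv by (simp add: bruhat_le_def)
  have wuv: "weight n w v = weight n w u"
    using maximizersD(1,2,4)[OF M(1)] maximizersD(1,2,4)[OF M(2)] by (simp add: antisym)
  obtain A B where order: "lex_refls 1 n \<asymp> A @ B"
    and A: "set A = {(p, q). (p, q) \<in> refls n \<and> w q < w p}"
    and B: "set B = {(p, q). (p, q) \<in> refls n \<and> w p \<le> w q}"
    by (rule strict_ascents_first)
  have subs: "set A \<subseteq> refls n" "set B \<subseteq> refls n" using set_reflection_order[OF order] by auto
  obtain z where z: "z permutes {1..n}" "chain_count n A u z \<noteq> 0" "chain_count n B z v \<noteq> 0"
    using chains_split[of n A B u v] chains_reflection_order[OF order uv] u subs by auto
  \<comment> \<open>The chain has no labels in \<open>A\<close>, since the first one would improve on \<open>u\<close>.\<close>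
  have "u = z"
  proof (rule ccontr)
    assume "u \<noteq> z"
    then obtain r where r: "r \<in> set A" "covers n u r" "bruhat_le n (act u r) z"
      using chains_first_step[OF z(2) _ u subs(1)] by blast
    then have "bruhat_le n u (act u r)" "weight n w u < weight n w (act u r)"
      using u A covers_bruhat_le weight_covers(1) by auto
    moreover have "bruhat_le n (act u r) v"
      using r chains_imp_bruhat_le[OF z(3) subs(2) z(1)] bruhat_le_trans by blast
    ultimately show False using maximizersD(4)[OF M(1), of "act u r"] by simp
  qed
  then have "chain_count n (filter ?lev B) u v \<noteq> 0"
    using chains_weight_level(2)[of B n w u v] B u z wuv by simp
  moreover have "filter ?lev A = []" using A by (auto simp: filter_empty_conv)
  ultimately have "chain_count n (filter ?lev (A @ B)) u v \<noteq> 0" by simp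
  moreover obtain A' B' where order': "lex_refls 1 n \<asymp> A' @ B'"
    and A': "set A' = {(p, q). (p, q) \<in> refls n \<and> - w q < - w p}"
    and B': "set B' = {(p, q). (p, q) \<in> refls n \<and> - w p \<le> - w q}"
    by (rule strict_ascents_first[of n "\<lambda>k. - w k"])
  have "A @ B \<asymp> A' @ B'" using order order' braid.sym braid.trans by blast
  then have "filter ?lev (A @ B) \<asymp> filter ?lev (A' @ B')" by (rule braid_filter_level)
  ultimately have "chain_count n (filter ?lev (A' @ B')) u v \<noteq> 0"
    using braid_chains[of "filter ?lev (A @ B)" "filter ?lev (A' @ B')" n u v] u subs by force
  moreover have "filter ?lev A' = []" using A' by (auto simp: filter_empty_conv)
  ultimately have "chain_count n (filter ?lev B') u v \<noteq> 0" by simp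
  then have B'uv: "chain_count n B' u v \<noteq> 0"
    using chains_filter_le[of n ?lev B' u v] by simp
  \<comment> \<open>A Bruhat-minimal minimizer of \<open>w\<close> is the turning point for the order adapted to \<open>- w\<close>, as is \<open>u\<close>.\<close>
  obtain m0 where "m0 \<in> maximizers n (\<lambda>k. - w k) u v"
    using maximizers_nonempty[OF uv] by blast
  then obtain m where m: "m \<in> maximizers n (\<lambda>k. - w k) u v"
    "\<And>x. x \<in> maximizers n (\<lambda>k. - w k) u v \<Longrightarrow> bruhat_le n x m \<Longrightarrow> x = m"
    by (rule below_minimal[OF _ maximizers_finite]) blast
  have "chain_count n A' u m \<noteq> 0" "chain_count n B' m v \<noteq> 0"
    using minimal_maximizer_is_turning_point[OF order' A' B' m] by auto
  then have "m = u"
    by (rule turning_point_unique[OF order' uv _ _ chains_self B'uv])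
  have neg: "weight n (\<lambda>k. - w k) x = - weight n w x" for x
    by (simp add: weight_def sum_negf)
  have "weight n w u \<le> weight n w y"
    using maximizersD(4)[OF m(1) y] \<open>m = u\<close> by (simp add: neg)
  moreover have "weight n w y \<le> weight n w u" using maximizersD(4)[OF M(1) y] .
  ultimately show ?thesis by simp
qed

text \<open>
  All Bruhat-minimal maximizers are turning points for one and the same reflection order and therefore
  coincide; likewise the maximal ones. So the maximizers lie between two of them, \<open>x\<close> and \<open>y\<close>,
  and the functional is constant on \<open>[x, y]\<close>.
\<close>

lemma maximizers_eq_interval:
  assumes uv: "bruhat_le n u v"
  obtains x y where "bruhat_le n x y" "maximizers n w u v = {z. bruhat_le n x z \<and> bruhat_le n z y}"
proof -
  let ?M = "maximizers n w u v"
  obtain z0 where z0: "z0 \<in> ?M" using maximizers_nonempty[OF uv] by blast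
  obtain x where x: "x \<in> ?M" "\<And>z. z \<in> ?M \<Longrightarrow> bruhat_le n z x \<Longrightarrow> z = x"
    by (rule below_minimal[OF z0 maximizers_finite]) blast
  obtain y where y: "y \<in> ?M" "\<And>z. z \<in> ?M \<Longrightarrow> bruhat_le n y z \<Longrightarrow> z = y"
    by (rule above_maximal[OF z0 maximizers_finite]) blast
  have ge: "bruhat_le n x z" if z: "z \<in> ?M" for z
  proof -
    obtain x' where x': "x' \<in> ?M" "bruhat_le n x' z" "\<And>z. z \<in> ?M \<Longrightarrow> bruhat_le n z x' \<Longrightarrow> z = x'"
      by (rule below_minimal[OF z maximizers_finite]) blast
    obtain A B where o: "lex_refls 1 n \<asymp> A @ B"
      "set A = {(p, q). (p, q) \<in> refls n \<and> w q < w p}"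
      "set B = {(p, q). (p, q) \<in> refls n \<and> w p \<le> w q}"
      by (rule strict_ascents_first)
    note t = minimal_maximizer_is_turning_point[OF o x]
    note t' = minimal_maximizer_is_turning_point[OF o x'(1,3)]
    have "x' = x"
      using t t' turning_point_unique[OF o(1) uv] by blast
    then show ?thesis using x' by simp
  qed
  have le: "bruhat_le n z y" if z: "z \<in> ?M" for z
  proof -
    obtain y' where y': "y' \<in> ?M" "bruhat_le n z y'" "\<And>z. z \<in> ?M \<Longrightarrow> bruhat_le n y' z \<Longrightarrow> z = y'"
      by (rule above_maximal[OF z maximizers_finite]) blast
    obtain A B where o: "lex_refls 1 n \<asymp> A @ B"
      "set A = {(p, q). (p, q) \<in> refls n \<and> w q \<le> w p}"
      "set B = {(p, q). (p, q) \<in> refls n \<and> w p < w q}"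
      by (rule weak_ascents_first)
    note t = maximal_maximizer_is_turning_point[OF o y]
    note t' = maximal_maximizer_is_turning_point[OF o y'(1,3)]
    have "y' = y"
      using t t' turning_point_unique[OF o(1) uv] by blast
    then show ?thesis using y' by simp
  qed
  have xy: "bruhat_le n x y" using ge y(1) by blast
  have in_uv: "bruhat_le n u z" "bruhat_le n z v" if "bruhat_le n x z" "bruhat_le n z y" for z
    using that maximizersD(1,2)[OF x(1)] maximizersD(1,2)[OF y(1)] bruhat_le_trans by blast+
  have refl: "bruhat_le n x x" "bruhat_le n y y"
    using maximizersD(3)[OF x(1)] maximizersD(3)[OF y(1)] bruhat_le_refl by auto
  have "x \<in> maximizers n w x y" "y \<in> maximizers n w x y"
    using x(1) y(1) xy refl in_uv unfolding maximizers_def by blast+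
  then have "weight n w z = weight n w x" if "bruhat_le n x z" "bruhat_le n z y" for z
    using weight_constant[OF xy] that by blast
  then have "z \<in> ?M" if "bruhat_le n x z" "bruhat_le n z y" for z
    using that in_uv[OF that] x(1) by (intro maximizersI[OF x(1)]) auto
  then have "?M = {z. bruhat_le n x z \<and> bruhat_le n z y}" using ge le by blast
  with xy show ?thesis by (rule that)
qed

section \<open>Faces of Bruhat interval polytopes\<close>

lemma inner_perm_vector:
  fixes e :: "'n::finite \<Rightarrow> nat"
  assumes "bij_betw e UNIV {1..n}"
  shows "a \<bullet> perm_vector e z = weight n (\<lambda>k. a $ inv_into UNIV e k) z"
proof -
  have "a \<bullet> perm_vector e z = (\<Sum>i\<in>UNIV. a $ inv_into UNIV e (e i) * real (z (e i)))"
    using assms by (simp add: inner_vec_def perm_vector_def bij_betw_def)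
  also have "\<dots> = weight n (\<lambda>k. a $ inv_into UNIV e k) z"
    unfolding weight_def using assms
    by (rule sum.reindex_bij_betw[where g = "\<lambda>k. a $ inv_into UNIV e k * real (z k)"])
  finally show ?thesis .
qed

text \<open>
  A face of a polytope is cut out by a supporting hyperplane and is the convex hull of the
  generators on it; these are the maximizers of the linear functional.
\<close>

theorem theorem4p1:
  fixes n :: nat and e :: "'n::finite \<Rightarrow> nat"
    and u v :: "nat \<Rightarrow> nat" and F :: "(real ^ 'n) set"
  assumes "bij_betw e UNIV {1..n}"
    and "u permutes {1..n}" and "v permutes {1..n}" and "bruhat_le n u v"
    and "F face_of bruhat_interval_polytope n e u v" and "F \<noteq> {}"
  shows "\<exists>x y. x permutes {1..n} \<and> y permutes {1..n} \<and> bruhat_le n x y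
    \<and> F = bruhat_interval_polytope n e x y"
proof -
  let ?X = "{z. z permutes {1..n} \<and> bruhat_le n u z \<and> bruhat_le n z v}"
  let ?V = "perm_vector e ` ?X" and ?Q = "bruhat_interval_polytope n e u v"
  have X: "?X = {z. bruhat_le n u z \<and> bruhat_le n z v}" by (auto simp: bruhat_le_def)
  have fin: "finite ?V" unfolding X by (intro finite_imageI finite_bruhat_interval)
  have Q: "?Q = convex hull ?V" by (simp add: bruhat_interval_polytope_def)
  have "polyhedron ?Q"
    unfolding Q using fin by (intro polytope_imp_polyhedron) (auto simp: polytope_def)
  then have "F exposed_face_of ?Q" using assms(5) exposed_face_of_polyhedron by blast
  then obtain a b where ab: "?Q \<subseteq> {x. a \<bullet> x \<le> b}" "F = ?Q \<inter> {x. a \<bullet> x = b}"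
    by (auto simp: exposed_face_of_def)
  define w where "w = (\<lambda>k. a $ inv_into UNIV e k)"
  have inner: "a \<bullet> perm_vector e z = weight n w z" for z
    unfolding w_def by (rule inner_perm_vector[OF assms(1)])
  obtain S where S: "S \<subseteq> ?V" "F = convex hull S"
    using face_of_convex_hull_subset[of ?V F] assms(5) fin unfolding Q
    by (auto intro: finite_imp_compact)
  have VF: "F = convex hull (?V \<inter> F)"
  proof
    show "F \<subseteq> convex hull (?V \<inter> F)"
      using S hull_subset[of S convex] hull_mono[of S "?V \<inter> F" convex] by blast
    have "convex F" using S(2) convex_convex_hull by metis
    then show "convex hull (?V \<inter> F) \<subseteq> F" by (intro hull_minimal) auto
  qed
  have VQ: "perm_vector e z \<in> ?Q" if "z \<in> ?X" for z
    unfolding Q using that by (intro hull_inc) auto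
  have le: "weight n w z \<le> b" if "z \<in> ?X" for z
    using VQ[OF that] ab(1) inner by auto
  have mem: "perm_vector e z \<in> F \<longleftrightarrow> weight n w z = b" if "z \<in> ?X" for z
    using VQ[OF that] inner by (simp add: ab(2))
  obtain z0 where z0: "z0 \<in> ?X" "weight n w z0 = b"
  proof -
    have "?V \<inter> F \<noteq> {}" using VF assms(6) by force
    then show ?thesis using that mem by blast
  qed
  have M: "maximizers n w u v = {z \<in> ?X. weight n w z = b}"
  proof (intro set_eqI iffI)
    fix z assume z: "z \<in> maximizers n w u v"
    then have "z \<in> ?X" "weight n w z0 \<le> weight n w z"
      using z0 maximizersD[OF z] by auto
    then show "z \<in> {z \<in> ?X. weight n w z = b}" using le[of z] z0 by auto
  next
    fix z assume "z \<in> {z \<in> ?X. weight n w z = b}"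
    then show "z \<in> maximizers n w u v"
      using le by (auto simp: maximizers_def X)
  qed
  obtain x y where xy: "bruhat_le n x y"
    "maximizers n w u v = {z. bruhat_le n x z \<and> bruhat_le n z y}"
    by (rule maximizers_eq_interval[OF assms(4)])
  have "?V \<inter> F = perm_vector e ` maximizers n w u v"
    unfolding M using mem by auto
  also have "\<dots> = perm_vector e ` {z. z permutes {1..n} \<and> bruhat_le n x z \<and> bruhat_le n z y}"
    unfolding xy(2) by (rule arg_cong[of _ _ "image _"]) (auto simp: bruhat_le_def)
  finally have "F = bruhat_interval_polytope n e x y"
    using VF by (simp add: bruhat_interval_polytope_def)
  then show ?thesis using xy(1) by (auto simp: bruhat_le_def)
qed

end
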